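(* Let $X$ be an affine variety. A nested unipotent subgroup $U\subseteq\operatorname{Aut}(X)$ is solvable of derived length $\leq\max\{\dim Ux\mid x\in X\}\leq\dim X$.
   Context: $\Bbbk$ is an algebraically closed field of characteristic zero; all varieties are over $\Bbbk$. $\operatorname{Aut}(X)$ is the group of regular automorphisms of $X$. An algebraic subgroup of $\operatorname{Aut}(X)$ is a subgroup which is the image of a linear algebraic group $G$ acting regularly on $X$ (i.e. $G\times X\to X$ is a morphism). A nested unipotent subgroup $U\subseteq\operatorname{Aut}(X)$ is a subgroup which is a union $U=\bigcup_iU_i$ of an ascending sequence $U_1\subseteq U_2\subseteq\cdots$ of unipotent algebraic subgroups of $\operatorname{Aut}(X)$. $Ux$ denotes the $U$-orbit of $x$ (which is a locally closed subvariety of $X$). The derived length of a solvable group $U$ is the smallest $d$ with $U^{(d)}=\{e\}$, where $U^{(0)}=U$ and $U^{(i+1)}=(U^{(i)},U^{(i)})$. *)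

theory Defs
  imports
    "HOL-Analysis.Abstract_Topology"
    "HOL-Library.Extended_Nat"
    "HOL-Algebra.Group_Action"
    "HOL-Algebra.Solvable_Groups"
    "Jordan_Normal_Form.Determinant"
begin

text \<open>
  Affine varieties are Zariski closed subsets \<open>X\<close> of the affine space \<open>carrier_vec n\<close>;
  irreducibility is not required.  Since the ground field is infinite, polynomials are
  identified with polynomial functions.
\<close>

inductive_set poly_funs :: "('p \<Rightarrow> 'k::comm_ring_1) set \<Rightarrow> ('p \<Rightarrow> 'k) set"
  for C where
    const: "(\<lambda>_. c) \<in> poly_funs C"
  | gen: "f \<in> C \<Longrightarrow> f \<in> poly_funs C"
  | add: "f \<in> poly_funs C \<Longrightarrow> g \<in> poly_funs C \<Longrightarrow> (\<lambda>x. f x + g x) \<in> poly_funs C"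
  | mult: "f \<in> poly_funs C \<Longrightarrow> g \<in> poly_funs C \<Longrightarrow> (\<lambda>x. f x * g x) \<in> poly_funs C"


subsection \<open>Affine varieties and their automorphism groups\<close>

definition vec_coords :: "nat \<Rightarrow> ('k vec \<Rightarrow> 'k) set" where
  "vec_coords n = {\<lambda>x. x $ i | i. i < n}"

definition zero_locus :: "nat \<Rightarrow> ('k::comm_ring_1 vec \<Rightarrow> 'k) set \<Rightarrow> 'k vec set" where
  "zero_locus n S = {x \<in> carrier_vec n. \<forall>f\<in>S. f x = 0}"

definition affine_variety :: "nat \<Rightarrow> 'k::field vec set \<Rightarrow> bool" where
  "affine_variety n X \<longleftrightarrow> (\<exists>S \<subseteq> poly_funs (vec_coords n). X = zero_locus n S)"

text \<open>Only the values of \<open>f\<close> on \<open>X\<close> matter.\<close>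

definition regular_self_map ::
    "nat \<Rightarrow> 'k::field vec set \<Rightarrow> ('k vec \<Rightarrow> 'k vec) \<Rightarrow> bool" where
  "regular_self_map n X f \<longleftrightarrow>
     f \<in> X \<rightarrow> X \<and> (\<forall>j<n. \<exists>p \<in> poly_funs (vec_coords n). \<forall>x\<in>X. f x $ j = p x)"

definition Aut :: "nat \<Rightarrow> 'k::field vec set \<Rightarrow> ('k vec \<Rightarrow> 'k vec) monoid" where
  "Aut n X = (BijGroup X)
     \<lparr>carrier := {f \<in> Bij X. regular_self_map n X f \<and> regular_self_map n X (inv_into X f)}\<rparr>"


subsection \<open>Linear algebraic groups and regular actions\<close>

definition GL :: "nat \<Rightarrow> 'k::field mat monoid" where
  "GL m = units_of (ring_mat TYPE('k) m ())"

definition mat_coords :: "nat \<Rightarrow> ('k mat \<Rightarrow> 'k) set" where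
  "mat_coords m = {\<lambda>g. g $$ (i, j) | i j. i < m \<and> j < m}"

definition linear_algebraic_group :: "nat \<Rightarrow> 'k::field mat set \<Rightarrow> bool" where
  "linear_algebraic_group m G \<longleftrightarrow>
     subgroup G (GL m) \<and>
     (\<exists>S \<subseteq> poly_funs (mat_coords m). G = {g \<in> carrier (GL m). \<forall>f\<in>S. f g = 0})"

definition unipotent_mat :: "nat \<Rightarrow> 'k::field mat \<Rightarrow> bool" where
  "unipotent_mat m g \<longleftrightarrow> (\<exists>k. (g - 1\<^sub>m m) ^\<^sub>m k = 0\<^sub>m m m)"

definition unipotent_group :: "nat \<Rightarrow> 'k::field mat set \<Rightarrow> bool" where
  "unipotent_group m G \<longleftrightarrow> linear_algebraic_group m G \<and> (\<forall>g\<in>G. unipotent_mat m g)"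

text \<open>
  Generators of the coordinate ring of \<open>GL\<^sub>m \<times> \<bbbA>\<^sup>n\<close>: matrix entries, the inverse of the
  determinant, and vector coordinates.
\<close>

definition action_coords :: "nat \<Rightarrow> nat \<Rightarrow> ('k::field mat \<times> 'k vec \<Rightarrow> 'k) set" where
  "action_coords m n =
     {\<lambda>(g, x). g $$ (i, j) | i j. i < m \<and> j < m} \<union> {\<lambda>(g, x). inverse (det g)} \<union>
     {\<lambda>(g, x). x $ i | i. i < n}"

definition regular_action ::
    "nat \<Rightarrow> 'k::field mat set \<Rightarrow> nat \<Rightarrow> 'k vec set \<Rightarrow> ('k mat \<Rightarrow> 'k vec \<Rightarrow> 'k vec) \<Rightarrow> bool" where
  "regular_action m G n X \<rho> \<longleftrightarrow>
     group_action ((GL m)\<lparr>carrier := G\<rparr>) X \<rho> \<and>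
     (\<forall>j<n. \<exists>p \<in> poly_funs (action_coords m n). \<forall>g\<in>G. \<forall>x\<in>X. \<rho> g x $ j = p (g, x))"

definition unipotent_algebraic_subgroup ::
    "nat \<Rightarrow> 'k::field vec set \<Rightarrow> ('k vec \<Rightarrow> 'k vec) set \<Rightarrow> bool" where
  "unipotent_algebraic_subgroup n X H \<longleftrightarrow>
     subgroup H (Aut n X) \<and>
     (\<exists>m G \<rho>. unipotent_group m G \<and> regular_action m G n X \<rho> \<and> H = \<rho> ` G)"

definition nested_unipotent_subgroup ::
    "nat \<Rightarrow> 'k::field vec set \<Rightarrow> ('k vec \<Rightarrow> 'k vec) set \<Rightarrow> bool" where
  "nested_unipotent_subgroup n X U \<longleftrightarrow>
     subgroup U (Aut n X) \<and>
     (\<exists>V :: nat \<Rightarrow> _. (\<forall>i. unipotent_algebraic_subgroup n X (V i)) \<and>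
        (\<forall>i. V i \<subseteq> V (Suc i)) \<and> U = (\<Union>i. V i))"


subsection \<open>Derived length\<close>

text \<open>Meaningful for solvable groups only.\<close>

definition derived_length :: "('a, 'b) monoid_scheme \<Rightarrow> nat" where
  "derived_length G = (LEAST d. (derived G ^^ d) (carrier G) = {\<one>\<^bsub>G\<^esub>})"


subsection \<open>Dimension\<close>

definition zariski :: "nat \<Rightarrow> 'k::field vec topology" where
  "zariski n = topology (\<lambda>W. \<exists>S \<subseteq> poly_funs (vec_coords n). W = carrier_vec n - zero_locus n S)"

lemma istopology_zariski:
  "istopology (\<lambda>W :: 'k::field vec set.
     \<exists>S \<subseteq> poly_funs (vec_coords n). W = carrier_vec n - zero_locus n S)"
  (is "istopology ?P")
  unfolding istopology_def
proof (intro conjI allI impI)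
  fix A B assume "?P A" "?P B"
  then obtain S T where S: "S \<subseteq> poly_funs (vec_coords n)" "A = carrier_vec n - zero_locus n S"
    and T: "T \<subseteq> poly_funs (vec_coords n)" "B = carrier_vec n - zero_locus n T"
    by auto
  let ?R = "(\<lambda>(f, g) x. f x * g x) ` (S \<times> T)"
  have "?R \<subseteq> poly_funs (vec_coords n)"
    using S(1) T(1) by (auto intro: poly_funs.mult)
  moreover have "A \<inter> B = carrier_vec n - zero_locus n ?R"
  proof (rule Set.set_eqI)
    fix x
    have "(\<forall>r\<in>?R. r x = 0) \<longleftrightarrow> (\<forall>f\<in>S. \<forall>g\<in>T. f x * g x = 0)"
      by simp
    also have "\<dots> \<longleftrightarrow> (\<forall>f\<in>S. f x = 0) \<or> (\<forall>g\<in>T. g x = 0)"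
      by auto
    finally show "x \<in> A \<inter> B \<longleftrightarrow> x \<in> carrier_vec n - zero_locus n ?R"
      unfolding S(2) T(2) zero_locus_def Diff_iff Int_iff mem_Collect_eq by argo
  qed
  ultimately show "?P (A \<inter> B)" by (intro exI[of _ ?R] conjI)
next
  fix K assume "\<forall>W\<in>K. ?P W"
  then obtain S where S: "\<And>W. W \<in> K \<Longrightarrow> S W \<subseteq> poly_funs (vec_coords n)"
      "\<And>W. W \<in> K \<Longrightarrow> W = carrier_vec n - zero_locus n (S W)"
    by metis
  have "(\<Union>W\<in>K. S W) \<subseteq> poly_funs (vec_coords n)"
    using S(1) by auto
  moreover have "\<Union>K = (\<Union>W\<in>K. carrier_vec n - zero_locus n (S W))"
    using S(2) by auto
  hence "\<Union>K = carrier_vec n - zero_locus n (\<Union>W\<in>K. S W)"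
    unfolding zero_locus_def by auto
  ultimately show "?P (\<Union>K)" by (intro exI[of _ "\<Union>W\<in>K. S W"] conjI)
qed

lemma openin_zariski:
  "openin (zariski n) W \<longleftrightarrow>
     (\<exists>S \<subseteq> poly_funs (vec_coords n). W = carrier_vec n - zero_locus n S)"
  unfolding zariski_def by (simp add: topology_inverse'[OF istopology_zariski])

lemma topspace_zariski: "topspace (zariski n :: 'k::field vec topology) = carrier_vec n"
proof
  show "topspace (zariski n :: 'k vec topology) \<subseteq> carrier_vec n"
    using openin_topspace[of "zariski n :: 'k vec topology"] unfolding openin_zariski by auto
  have "openin (zariski n) (carrier_vec n :: 'k vec set)"
    unfolding openin_zariski
    by (rule exI[of _ "{\<lambda>_. 1}"]) (auto simp: zero_locus_def intro: poly_funs.const)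
  thus "carrier_vec n \<subseteq> topspace (zariski n :: 'k vec topology)"
    by (rule openin_subset)
qed

lemma closedin_zariski: "closedin (zariski n) X \<longleftrightarrow> affine_variety n X"
proof -
  have "closedin (zariski n) X \<longleftrightarrow> X \<subseteq> carrier_vec n \<and>
      (\<exists>S \<subseteq> poly_funs (vec_coords n). carrier_vec n - X = carrier_vec n - zero_locus n S)"
    unfolding closedin_def topspace_zariski openin_zariski ..
  also have "\<dots> \<longleftrightarrow> affine_variety n X"
  proof -
    have *: "X \<subseteq> carrier_vec n \<and> carrier_vec n - X = carrier_vec n - zero_locus n S
        \<longleftrightarrow> X = zero_locus n S" for S
    proof -
      have "zero_locus n S \<subseteq> carrier_vec n"
        unfolding zero_locus_def by (rule Collect_restrict)
      thus ?thesis by blast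
    qed
    show ?thesis
      unfolding affine_variety_def
    proof (intro iffI; elim conjE exE)
      fix S assume "X \<subseteq> carrier_vec n" "S \<subseteq> poly_funs (vec_coords n)"
        "carrier_vec n - X = carrier_vec n - zero_locus n S"
      thus "\<exists>S \<subseteq> poly_funs (vec_coords n). X = zero_locus n S"
        using *[of S] by (intro exI[of _ S] conjI) simp_all
    next
      fix S assume S: "S \<subseteq> poly_funs (vec_coords n)" "X = zero_locus n S"
      have "X \<subseteq> carrier_vec n"
        unfolding S(2) zero_locus_def by (rule Collect_restrict)
      thus "X \<subseteq> carrier_vec n \<and>
          (\<exists>S \<subseteq> poly_funs (vec_coords n). carrier_vec n - X = carrier_vec n - zero_locus n S)"
        using S by (intro conjI exI[of _ S]) simp_all
    qed
  qed
  finally show ?thesis .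
qed

definition irreducible_in :: "'a topology \<Rightarrow> 'a set \<Rightarrow> bool" where
  "irreducible_in T C \<longleftrightarrow> C \<subseteq> topspace T \<and> C \<noteq> {} \<and>
     (\<forall>A B. closedin T A \<longrightarrow> closedin T B \<longrightarrow> C \<subseteq> A \<union> B \<longrightarrow> C \<subseteq> A \<or> C \<subseteq> B)"

text \<open>Krull dimension; the empty space gets dimension \<open>0\<close> here.\<close>

definition krull_dim :: "'a topology \<Rightarrow> enat" where
  "krull_dim T = Sup {enat l | l. \<exists>C :: nat \<Rightarrow> 'a set.
     (\<forall>i\<le>l. closedin T (C i) \<and> irreducible_in T (C i)) \<and> (\<forall>i<l. C i \<subset> C (Suc i))}"

definition variety_dim :: "nat \<Rightarrow> 'k::field vec set \<Rightarrow> enat" where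
  "variety_dim n Y = krull_dim (subtopology (zariski n) Y)"

end

theory Submission
  imports Defs "Jordan_Normal_Form.Char_Poly"
begin

text \<open>
  Write \<open>U = \<Union>\<^sub>i V\<^sub>i\<close> with \<open>V\<^sub>i\<close> the image of a closed unipotent matrix group \<open>G\<close>, and let
  \<open>U\<^sup>(\<^sup>k\<^sup>)\<close> be the derived series.  The theorem follows from one statement about a single point: if
  \<open>U\<^sup>(\<^sup>d\<^sup>)\<close> moves \<open>x\<close>, then \<open>dim U x \<ge> d + 1\<close>.  Indeed, if \<open>d\<close> is the largest orbit dimension then
  \<open>U\<^sup>(\<^sup>d\<^sup>)\<close> fixes every point, so it is trivial.  As \<open>U\<^sup>(\<^sup>d\<^sup>)\<close> is the union of the \<open>V\<^sub>i\<^sup>(\<^sup>d\<^sup>)\<close>, some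
  single \<open>V\<^sub>i\<^sup>(\<^sup>d\<^sup>)\<close> already moves \<open>x\<close>, and the Zariski closures in \<open>U x\<close> of the orbits
  \<open>V\<^sub>i\<^sup>(\<^sup>k\<^sup>) x\<close>, for \<open>k = d + 1, d, \<dots>, 0\<close>, form a chain of closed sets.  It has to be shown that
  they are irreducible and that the inclusions are strict (\<open>derived_moves_imp_dim_ge\<close>).

  Irreducibility comes from polynomial paths.  For a unipotent matrix \<open>g\<close> over a
  field of characteristic zero the powers \<open>g\<^sup>t = \<Sum>\<^sub>k (t choose k) (g - 1)\<^sup>k\<close> depend polynomially on
  \<open>t\<close>; they lie in \<open>G\<close> for natural \<open>t\<close>, hence for all \<open>t\<close> in the field because \<open>G\<close> is closed.  So
  every element of \<open>G\<close> is joined to \<open>1\<close> by a polynomial path inside \<open>G\<close>.  Commutators and products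
  of paths are paths, so each derived subgroup inherits the property, and any two points of one of
  its orbits lie on a polynomial curve inside that orbit.  Two closed sets covering the orbit
  would give two polynomials in one variable with product zero (\<open>orbit_irreducible\<close>).

  Strictness comes from an invariant function.  By Kolchin's theorem there is a number \<open>N\<close> such
  that all products \<open>(g\<^sub>1 - 1) \<cdots> (g\<^sub>N - 1)\<close> of elements of \<open>G\<close> vanish
  (\<open>unipotent_products_vanish\<close>).  Hence the difference operators \<open>f \<mapsto> f \<circ> g - f\<close>, applied
  sufficiently often, kill every regular function on \<open>X\<close>.  If a subgroup \<open>H\<close> of \<open>G\<close> moves \<open>x\<close>, then
  some coordinate function is not constant on \<open>H x\<close>; applying differences as long as the
  result stays nonconstant leads to a regular function \<open>f\<close>, nonconstant on \<open>H x\<close>, all of whose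
  differences by elements of \<open>H\<close> are constant on \<open>H x\<close>.  The constants define a homomorphism from
  \<open>H\<close> to the additive group of the field, so \<open>f\<close> takes the value \<open>f x\<close> on the orbit of the commutator
  subgroup (\<open>separating_polynomial\<close>).

  Kolchin's theorem is proved with traces.  The linear span of the matrices \<open>g - 1\<close> is closed under
  multiplication and consists of matrices of trace zero; as all powers of such a matrix have
  trace zero, Newton's identities make it nilpotent.  An algebra of nilpotent matrices has a common
  null vector modulo any proper invariant subspace (\<open>nil_algebra_null_vector\<close>).

  Finally, the maximum in the theorem is meaningful because every subset of affine \<open>n\<close>-space has
  dimension at most \<open>n\<close> (\<open>variety_dim_le\<close>).  A chain of irreducible closed sets yields algebraically
  independent polynomials, one for each step, and more than \<open>n\<close> polynomials in \<open>n\<close> variables are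
  dependent by counting monomials.
\<close>


section \<open>Polynomial functions\<close>

lemma poly_funs_sum:
  assumes "\<And>i. i \<in> I \<Longrightarrow> f i \<in> poly_funs C" shows "(\<lambda>x. \<Sum>i\<in>I. f i x) \<in> poly_funs C"
  using assms
proof (induction I rule: infinite_finite_induct)
  case (insert i I) thus ?case using poly_funs.add[of "f i" C] by simp
qed (use poly_funs.const[of 0 C] in simp_all)

lemma poly_funs_prod:
  assumes "\<And>i. i \<in> I \<Longrightarrow> f i \<in> poly_funs C" shows "(\<lambda>x. \<Prod>i\<in>I. f i x) \<in> poly_funs C"
  using assms
proof (induction I rule: infinite_finite_induct)
  case (insert i I) thus ?case using poly_funs.mult[of "f i" C] by simp
qed (use poly_funs.const[of 1 C] in simp_all)

lemma poly_funs_power: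
  assumes "f \<in> poly_funs C" shows "(\<lambda>x. f x ^ k) \<in> poly_funs C"
  by (induction k) (use poly_funs.mult[OF assms] poly_funs.const[of 1 C] in auto)

lemma poly_funs_diff:
  assumes "f \<in> poly_funs C" "g \<in> poly_funs C" shows "(\<lambda>x. f x - g x) \<in> poly_funs C"
  using poly_funs.add[OF assms(1) poly_funs.mult[OF poly_funs.const[of "-1"] assms(2)]] by simp

lemma poly_funs_det:
  assumes "\<And>i j. i < m \<Longrightarrow> j < m \<Longrightarrow> (\<lambda>x. M x $$ (i, j)) \<in> poly_funs C"
  obtains q where "q \<in> poly_funs C" "\<And>x. M x \<in> carrier_mat m m \<Longrightarrow> det (M x) = q x"
proof
  let ?q = "\<lambda>x. \<Sum>p\<in>{p. p permutes {0..<m}}. signof p * (\<Prod>i = 0..<m. M x $$ (i, p i))"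
  show "?q \<in> poly_funs C"
    by (intro poly_funs_sum poly_funs.mult poly_funs.const poly_funs_prod assms)
       (auto dest: permutes_nat_less)
  show "det (M x) = ?q x" if "M x \<in> carrier_mat m m" for x by (rule det_def'[OF that])
qed

text \<open>
  The version relative to a set \<open>X\<close> is for coordinates of regular maps, which agree with polynomials
  only on \<open>X\<close>.
\<close>
lemma poly_funs_subst:
  assumes "p \<in> poly_funs C" and "\<And>f. f \<in> C \<Longrightarrow> \<exists>q\<in>poly_funs C'. \<forall>x\<in>X. f (h x) = q x"
  shows "\<exists>q\<in>poly_funs C'. \<forall>x\<in>X. p (h x) = q x"
  using assms(1)
proof (induction rule: poly_funs.induct)
  case (const c)
  show ?case by (rule bexI[OF _ poly_funs.const[of c]]) simp
next
  case (gen f) thus ?case by (rule assms(2))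
next
  case (add f g)
  then obtain q r where "q \<in> poly_funs C'" "\<forall>x\<in>X. f (h x) = q x" "r \<in> poly_funs C'" "\<forall>x\<in>X. g (h x) = r x"
    by blast
  thus ?case by (intro bexI[OF _ poly_funs.add[of q C' r]]) auto
next
  case (mult f g)
  then obtain q r where "q \<in> poly_funs C'" "\<forall>x\<in>X. f (h x) = q x" "r \<in> poly_funs C'" "\<forall>x\<in>X. g (h x) = r x"
    by blast
  thus ?case by (intro bexI[OF _ poly_funs.mult[of q C' r]]) auto
qed

lemma poly_funs_subst_UNIV:
  assumes "p \<in> poly_funs C" and "\<And>f. f \<in> C \<Longrightarrow> (\<lambda>x. f (h x)) \<in> poly_funs C'"
  shows "(\<lambda>x. p (h x)) \<in> poly_funs C'"
  using assms(1) by (induction rule: poly_funs.induct) (auto intro: poly_funs.intros assms(2))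

abbreviation upoly_funs :: "('k::comm_ring_1 \<Rightarrow> 'k) set" where
  "upoly_funs \<equiv> poly_funs {\<lambda>t. t}"

lemma upoly_funs_poly: "f \<in> upoly_funs \<Longrightarrow> \<exists>p. f = poly p"
proof (induction rule: poly_funs.induct)
  case (const c)
  have "(\<lambda>_. c) = poly [:c:]" by auto
  thus ?case by blast
next
  case (gen f)
  hence "f = poly [:0, 1:]" by auto
  thus ?case by blast
next
  case (add f g)
  then obtain p q where "f = poly p" "g = poly q" by blast
  hence "(\<lambda>x. f x + g x) = poly (p + q)" by auto
  thus ?case by blast
next
  case (mult f g)
  then obtain p q where "f = poly p" "g = poly q" by blast
  hence "(\<lambda>x. f x * g x) = poly (p * q)" by auto
  thus ?case by blast
qed

text \<open>In characteristic zero the natural numbers are infinitely many points of the field.\<close>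
lemma upoly_funs_zero:
  fixes f :: "'k::field_char_0 \<Rightarrow> 'k"
  assumes "f \<in> upoly_funs" "\<And>n. f (of_nat n) = 0"
  shows "f t = 0"
proof -
  obtain p where p: "f = poly p" using upoly_funs_poly[OF assms(1)] by blast
  have "infinite (range (of_nat :: nat \<Rightarrow> 'k))" by (rule range_inj_infinite) (simp add: inj_on_def)
  moreover have "range of_nat \<subseteq> {x. poly p x = 0}" using assms(2) p by auto
  ultimately have "p = 0" using poly_roots_finite[of p] finite_subset by blast
  thus ?thesis using p by simp
qed

lemma upoly_funs_idom:
  fixes f :: "'k::field_char_0 \<Rightarrow> 'k"
  assumes "f \<in> upoly_funs" "g \<in> upoly_funs" "\<And>t. f t * g t = 0"
  shows "(\<forall>t. f t = 0) \<or> (\<forall>t. g t = 0)"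
proof -
  obtain p q where pq: "f = poly p" "g = poly q" using upoly_funs_poly assms(1,2) by blast
  have "poly (p * q) = poly 0" using assms(3) pq by auto
  hence "p = 0 \<or> q = 0" by (metis poly_eq_poly_eq_iff mult_eq_0_iff)
  thus ?thesis using pq by auto
qed

section \<open>Krull dimension of subsets of affine space\<close>

text \<open>
  The linear span of a set of functions; the inductive form provides the induction over linear
  combinations that is needed for products.
\<close>
inductive_set fun_span :: "('p \<Rightarrow> 'k::field) set \<Rightarrow> ('p \<Rightarrow> 'k) set" for B where
  zero: "(\<lambda>_. 0) \<in> fun_span B"
| add: "f \<in> fun_span B \<Longrightarrow> b \<in> B \<Longrightarrow> (\<lambda>x. f x + c * b x) \<in> fun_span B"

lemma fun_span_base: "b \<in> B \<Longrightarrow> b \<in> fun_span B"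
  using fun_span.add[OF fun_span.zero, of b B 1] by simp

lemma fun_span_add:
  assumes "f \<in> fun_span B" "g \<in> fun_span B" shows "(\<lambda>x. f x + g x) \<in> fun_span B"
  using assms(2)
proof (induction rule: fun_span.induct)
  case (add g b c)
  thus ?case using fun_span.add[OF add.IH add.hyps(2), of c] by (simp add: add.assoc)
qed (use assms(1) in simp)

lemma fun_span_smult: "f \<in> fun_span B \<Longrightarrow> (\<lambda>x. d * f x) \<in> fun_span B"
proof (induction rule: fun_span.induct)
  case zero thus ?case by (simp add: fun_span.zero)
next
  case (add f b c)
  thus ?case using fun_span.add[OF add.IH add.hyps(2), of "d * c"] by (simp add: algebra_simps)
qed

lemma fun_span_mono: "B \<subseteq> B' \<Longrightarrow> f \<in> fun_span B \<Longrightarrow> f \<in> fun_span B'"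
  by (rotate_tac, induction rule: fun_span.induct) (auto intro: fun_span.intros)

lemma fun_span_mult:
  assumes "f \<in> fun_span B" "g \<in> fun_span B'" and prod: "\<And>b b'. b \<in> B \<Longrightarrow> b' \<in> B' \<Longrightarrow> (\<lambda>x. b x * b' x) \<in> fun_span B''"
  shows "(\<lambda>x. f x * g x) \<in> fun_span B''"
  using assms(1)
proof (induction rule: fun_span.induct)
  case zero thus ?case by (simp add: fun_span.zero)
next
  case (add f b c)
  have "(\<lambda>x. b x * g x) \<in> fun_span B''"
    using assms(2)
  proof (induction rule: fun_span.induct)
    case zero thus ?case by (simp add: fun_span.zero)
  next
    case (add g b' d)
    thus ?case using fun_span_add[OF add.IH fun_span_smult[OF prod[OF \<open>b \<in> B\<close> add.hyps(2)], of d]]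
      by (simp add: algebra_simps)
  qed
  from fun_span_add[OF add.IH fun_span_smult[OF this, of c]] show ?case by (simp add: algebra_simps)
qed

lemma fun_span_insert:
  assumes "f \<in> fun_span (insert b B)"
  obtains g d where "g \<in> fun_span B" "f = (\<lambda>x. g x + d * b x)"
proof -
  have "\<exists>g d. g \<in> fun_span B \<and> f = (\<lambda>x. g x + d * b x)"
    using assms
  proof (induction rule: fun_span.induct)
    case zero
    show ?case using fun_span.zero[of B] by (intro exI[of _ "\<lambda>_. 0"] exI[of _ 0]) auto
  next
    case (add f b' c)
    then obtain g d where g: "g \<in> fun_span B" "f = (\<lambda>x. g x + d * b x)" by blast
    show ?case
    proof (cases "b' = b")
      case True
      thus ?thesis using g by (intro exI[of _ g] exI[of _ "d + c"]) (auto simp: algebra_simps)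
    next
      case False
      hence "(\<lambda>x. g x + c * b' x) \<in> fun_span B" using add.hyps(2) g(1) by (intro fun_span.add) auto
      thus ?thesis using g(2)
        by (intro exI[of _ "\<lambda>x. g x + c * b' x"] exI[of _ d]) (auto simp: algebra_simps)
    qed
  qed
  thus thesis using that by blast
qed

text \<open>
  Gaussian elimination on the spanning set: one function with a nonzero coefficient at \<open>b\<close> is used
  to remove \<open>b\<close> from all the others.
\<close>
lemma fun_span_dependent:
  fixes f :: "'i \<Rightarrow> 'p \<Rightarrow> 'k::field"
  assumes "finite B" "finite I" "card B < card I" "\<And>i. i \<in> I \<Longrightarrow> f i \<in> fun_span B"
  obtains c i where "i \<in> I" "c i \<noteq> 0" "\<And>x. (\<Sum>i\<in>I. c i * f i x) = 0"
proof -
  have "\<exists>c. (\<exists>i\<in>I. c i \<noteq> 0) \<and> (\<forall>x. (\<Sum>i\<in>I. c i * f i x) = 0)"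
    using assms
  proof (induction B arbitrary: I f rule: finite_induct)
    case empty
    have "g = (\<lambda>_. 0)" if "g \<in> fun_span {}" for g :: "'p \<Rightarrow> 'k"
      using that by (induction rule: fun_span.induct) auto
    hence "\<forall>x. (\<Sum>i\<in>I. 1 * f i x) = 0" using empty by (auto intro!: sum.neutral dest: fun_cong)
    moreover have "I \<noteq> {}" using empty by auto
    ultimately show ?case by (intro exI[of _ "\<lambda>_. 1"]) auto
  next
    case (insert b B)
    have "\<forall>i\<in>I. \<exists>g d. g \<in> fun_span B \<and> f i = (\<lambda>x. g x + d * b x)"
      using insert.prems(3) fun_span_insert by metis
    then obtain g d where gd: "\<And>i. i \<in> I \<Longrightarrow> g i \<in> fun_span B" 
      "\<And>i. i \<in> I \<Longrightarrow> f i = (\<lambda>x. g i x + d i * b x)" by metis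
    show ?case
    proof (cases "\<forall>i\<in>I. d i = 0")
      case True
      hence "\<And>i. i \<in> I \<Longrightarrow> f i \<in> fun_span B" using gd by simp
      thus ?thesis using insert.IH[of I f] insert.prems insert.hyps by simp
    next
      case False
      then obtain j where j: "j \<in> I" "d j \<noteq> 0" by blast
      define h where "h i = (\<lambda>x. f i x + (- (d i / d j)) * f j x)" for i
      have h: "h i \<in> fun_span B" if "i \<in> I" for i
      proof -
        have "h i = (\<lambda>x. g i x + (- (d i / d j)) * g j x)"
          using gd(2)[OF that] gd(2)[OF j(1)] j(2) by (auto simp: h_def field_simps)
        thus ?thesis using fun_span_add[OF gd(1)[OF that] fun_span_smult[OF gd(1)[OF j(1)], of "- (d i / d j)"]] by simp
      qed
      have "card B < card (I - {j})" using insert j by simp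
      then obtain c where c: "\<exists>i\<in>I - {j}. c i \<noteq> 0" "\<And>x. (\<Sum>i\<in>I - {j}. c i * h i x) = 0"
        using insert.IH[of "I - {j}" h] h insert.prems by auto
      define c' where "c' = c(j := - (\<Sum>i\<in>I - {j}. c i * (d i / d j)))"
      have "(\<Sum>i\<in>I. c' i * f i x) = 0" for x
      proof -
        have "(\<Sum>i\<in>I. c' i * f i x) = c' j * f j x + (\<Sum>i\<in>I - {j}. c' i * f i x)"
          using j insert.prems by (simp add: sum.remove)
        also have "(\<Sum>i\<in>I - {j}. c' i * f i x) = (\<Sum>i\<in>I - {j}. c i * f i x)"
          by (intro sum.cong) (auto simp: c'_def)
        also have "c' j * f j x = (\<Sum>i\<in>I - {j}. c i * (- (d i / d j)) * f j x)"
          by (simp add: c'_def sum_distrib_right sum_negf)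
        finally have "(\<Sum>i\<in>I. c' i * f i x) = (\<Sum>i\<in>I - {j}. c i * h i x)"
          by (simp add: h_def algebra_simps sum_subtractf sum_negf)
        thus ?thesis using c(2) by simp
      qed
      moreover have "\<exists>i\<in>I. c' i \<noteq> 0" using c(1) by (auto simp: c'_def)
      ultimately show ?thesis by blast
    qed
  qed
  thus thesis using that by blast
qed

definition vec_monom :: "nat \<Rightarrow> (nat \<Rightarrow> nat) \<Rightarrow> 'k::field vec \<Rightarrow> 'k" where
  "vec_monom n a x = (\<Prod>i<n. x $ i ^ a i)"

text \<open>
  Bounding each exponent, rather than the total degree, makes the number of monomials a plain
  power.
\<close>
definition vec_monoms :: "nat \<Rightarrow> nat \<Rightarrow> ('k::field vec \<Rightarrow> 'k) set" where
  "vec_monoms n D = vec_monom n ` PiE {..<n} (\<lambda>_. {..D})"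

lemma vec_monom_mem: 
  assumes "\<And>i. i < n \<Longrightarrow> a i \<le> D" shows "vec_monom n a \<in> vec_monoms n D"
proof -
  have "vec_monom n a = (vec_monom n (restrict a {..<n}) :: 'a vec \<Rightarrow> 'a)"
    by (auto simp: vec_monom_def)
  thus ?thesis using assms by (auto simp: vec_monoms_def)
qed

lemma finite_vec_monoms: "finite (vec_monoms n D)"
  unfolding vec_monoms_def by (intro finite_imageI finite_PiE) auto

lemma card_vec_monoms: "card (vec_monoms n D) \<le> Suc D ^ n"
proof -
  have "card (vec_monoms n D) \<le> card (PiE {..<n} (\<lambda>_. {..D}))"
    unfolding vec_monoms_def by (intro card_image_le finite_PiE) auto
  thus ?thesis by (simp add: card_PiE)
qed

lemma vec_monoms_mult:
  assumes "f \<in> fun_span (vec_monoms n D)" "g \<in> fun_span (vec_monoms n E)"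
  shows "(\<lambda>x. f x * g x) \<in> fun_span (vec_monoms n (D + E))"
proof (rule fun_span_mult[OF assms])
  fix b b' :: "'a vec \<Rightarrow> 'a" assume "b \<in> vec_monoms n D" "b' \<in> vec_monoms n E"
  then obtain a a' where a: "b = vec_monom n a" "b' = vec_monom n a'" 
    "\<And>i. i < n \<Longrightarrow> a i \<le> D" "\<And>i. i < n \<Longrightarrow> a' i \<le> E"
    by (auto simp: vec_monoms_def PiE_def Pi_def)
  have "(\<lambda>x. b x * b' x) = vec_monom n (\<lambda>i. a i + a' i)"
    by (auto simp: a vec_monom_def power_add prod.distrib)
  also have "\<dots> \<in> vec_monoms n (D + E)" using a(3,4) by (intro vec_monom_mem add_mono) auto
  finally show "(\<lambda>x. b x * b' x) \<in> fun_span (vec_monoms n (D + E))" by (rule fun_span_base)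
qed

lemma vec_monoms_mono: "D \<le> E \<Longrightarrow> vec_monoms n D \<subseteq> vec_monoms n E"
  by (fastforce simp: vec_monoms_def PiE_def Pi_def)

lemma vec_monoms_one: "(\<lambda>_. 1) \<in> fun_span (vec_monoms n D)"
proof -
  have "(\<lambda>_. 1) = (vec_monom n (\<lambda>_. 0) :: 'a vec \<Rightarrow> 'a)" by (auto simp: vec_monom_def)
  also have "\<dots> \<in> fun_span (vec_monoms n D)" by (intro fun_span_base vec_monom_mem) auto
  finally show ?thesis .
qed

lemma poly_funs_bounded_degree:
  "p \<in> poly_funs (vec_coords n) \<Longrightarrow> \<exists>D. p \<in> fun_span (vec_monoms n D)"
proof (induction rule: poly_funs.induct)
  case (const c)
  thus ?case using fun_span_smult[OF vec_monoms_one[of n 0], of c] by auto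
next
  case (gen f)
  then obtain i where i: "i < n" "f = (\<lambda>x. x $ i)" by (auto simp: vec_coords_def)
  have "f = vec_monom n (\<lambda>j. if j = i then 1 else 0)"
    using i by (auto simp: vec_monom_def if_distrib prod.delta cong: if_cong)
  also have "\<dots> \<in> fun_span (vec_monoms n 1)" by (intro fun_span_base vec_monom_mem) auto
  finally show ?case by blast
next
  case (add f g)
  then obtain D E where "f \<in> fun_span (vec_monoms n D)" "g \<in> fun_span (vec_monoms n E)" by blast
  hence "f \<in> fun_span (vec_monoms n (max D E))" "g \<in> fun_span (vec_monoms n (max D E))"
    using fun_span_mono[OF vec_monoms_mono] by (meson max.cobounded1 max.cobounded2)+
  thus ?case using fun_span_add by blast
next
  case (mult f g)
  thus ?case using vec_monoms_mult by blast
qed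

lemma vec_monoms_power:
  assumes "f \<in> fun_span (vec_monoms n D)"
  shows "(\<lambda>x. f x ^ k) \<in> fun_span (vec_monoms n (k * D))"
proof (induction k)
  case 0 thus ?case using vec_monoms_one by simp
next
  case (Suc k)
  thus ?case using vec_monoms_mult[OF assms Suc] by simp
qed

lemma vec_monoms_prod:
  assumes "\<And>i. i < l \<Longrightarrow> f i \<in> fun_span (vec_monoms n D)"
  shows "(\<lambda>x. \<Prod>i<l. f i x) \<in> fun_span (vec_monoms n (l * D))"
  using assms
proof (induction l)
  case 0 thus ?case using vec_monoms_one by simp
next
  case (Suc l)
  have "(\<lambda>x. (\<Prod>i<l. f i x) * f l x) \<in> fun_span (vec_monoms n (l * D + D))"
    using Suc by (intro vec_monoms_mult) auto
  thus ?case by (simp add: algebra_simps)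
qed

text \<open>
  A function \<open>f\<^sub>i\<close> vanishing on \<open>Z\<^sub>i\<close> but not on \<open>Z\<^sub>i\<^sub>+\<^sub>1\<close> for each step of a chain of sets with prime
  vanishing ideals: such functions are algebraically independent.  Order a relation among
  \<open>f\<^sub>0, \<dots>, f\<^sub>l\<close> by powers of \<open>f\<^sub>l\<close>.  The lowest power of \<open>f\<^sub>l\<close> can be cancelled on \<open>Z\<^sub>l\<^sub>+\<^sub>1\<close>, since the
  vanishing ideal is prime, and restricting what remains to \<open>Z\<^sub>l\<close>, where \<open>f\<^sub>l\<close> vanishes, leaves a relation
  among \<open>f\<^sub>0, \<dots>, f\<^sub>l\<^sub>-\<^sub>1\<close>.  The polynomial relation is encoded by its coefficients \<open>c\<close>, indexed by exponent
  functions with values below \<open>s\<close>.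
\<close>
lemma chain_independent:
  fixes f :: "nat \<Rightarrow> 'p \<Rightarrow> 'k::field" and Z :: "nat \<Rightarrow> 'p set"
  assumes prime: "\<And>i p q. i \<le> l \<Longrightarrow> p \<in> poly_funs C \<Longrightarrow> q \<in> poly_funs C \<Longrightarrow>
      (\<And>x. x \<in> Z i \<Longrightarrow> p x * q x = 0) \<Longrightarrow> (\<forall>x\<in>Z i. p x = 0) \<or> (\<forall>x\<in>Z i. q x = 0)"
    and ne: "Z 0 \<noteq> {}" and sub: "\<And>i. i < l \<Longrightarrow> Z i \<subseteq> Z (Suc i)"
    and f: "\<And>i. i < l \<Longrightarrow> f i \<in> poly_funs C" "\<And>i x. i < l \<Longrightarrow> x \<in> Z i \<Longrightarrow> f i x = 0"
      "\<And>i. i < l \<Longrightarrow> \<exists>x\<in>Z (Suc i). f i x \<noteq> 0"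
    and zero: "\<And>x. x \<in> Z l \<Longrightarrow> (\<Sum>a\<in>PiE {..<l} (\<lambda>_. {..<s}). c a * (\<Prod>i<l. f i x ^ a i)) = 0"
    and a: "a \<in> PiE {..<l} (\<lambda>_. {..<s::nat})"
  shows "c a = 0"
  using assms
proof (induction l arbitrary: c a)
  case 0
  then obtain x where "x \<in> Z 0" by blast
  thus ?case using 0 by simp
next
  case (Suc l)
  note IH = Suc.IH
  note prime = Suc.prems(1) and ne = Suc.prems(2) and sub = Suc.prems(3) and f = Suc.prems(4-6)
    and zero = Suc.prems(7) and a = Suc.prems(8)
  let ?P = "PiE {..<l} (\<lambda>_. {..<s})"
  \<comment> \<open>\<open>Q k\<close> is the coefficient of the \<open>k\<close>-th power of \<open>f l\<close> in the relation.\<close>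
  define Q where "Q k x = (\<Sum>a\<in>?P. c (a(l := k)) * (\<Prod>i<l. f i x ^ a i))" for k x
  have poly_mon: "(\<lambda>x. \<Prod>i<l. f i x ^ a i) \<in> poly_funs C" for a
    by (intro poly_funs_prod poly_funs_power f(1)) simp
  have Q: "Q k \<in> poly_funs C" for k
    unfolding Q_def[abs_def] by (intro poly_funs_sum poly_funs.mult poly_funs.const poly_mon)
  have expand: "(\<Sum>k<s. Q k x * f l x ^ k) = 0" if "x \<in> Z (Suc l)" for x
  proof -
    have eq: "PiE {..<Suc l} (\<lambda>_. {..<s}) = (\<lambda>(k, a). a(l := k)) ` ({..<s} \<times> ?P)"
      using PiE_insert_eq[of l "{..<l}" "\<lambda>_. {..<s}"] by (simp add: lessThan_Suc)
    have inj: "inj_on (\<lambda>(k, a). a(l := k)) ({..<s} \<times> ?P)"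
      using inj_combinator[of l "{..<l}" "\<lambda>_. {..<s}"] by simp
    have "0 = (\<Sum>(k,a)\<in>{..<s} \<times> ?P. c (a(l := k)) * (\<Prod>i<Suc l. f i x ^ (a(l := k)) i))"
      using zero[OF that] unfolding eq sum.reindex[OF inj] by (simp add: case_prod_unfold)
    also have "\<dots> = (\<Sum>k<s. \<Sum>a\<in>?P. c (a(l := k)) * (\<Prod>i<Suc l. f i x ^ (a(l := k)) i))"
      by (simp add: sum.cartesian_product)
    also have "\<dots> = (\<Sum>k<s. Q k x * f l x ^ k)"
      unfolding Q_def sum_distrib_right
      by (intro sum.cong refl) (simp add: mult.assoc)
    finally show ?thesis by simp
  qed
  have cancel: "\<forall>x\<in>Z (Suc l). q x = 0" 
    if "q \<in> poly_funs C" "\<And>x. x \<in> Z (Suc l) \<Longrightarrow> f l x ^ k * q x = 0" for q k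
    using that
  proof (induction k)
    case 0 thus ?case by simp
  next
    case (Suc k)
    have "(\<forall>x\<in>Z (Suc l). f l x = 0) \<or> (\<forall>x\<in>Z (Suc l). f l x ^ k * q x = 0)"
      using Suc.prems f(1) by (intro prime poly_funs.mult poly_funs_power) (auto simp: mult.assoc)
    thus ?case using Suc.IH[OF Suc.prems(1)] f(3)[of l] by blast
  qed
  have coeffs: "\<forall>a\<in>?P. c (a(l := k)) = 0" if "k < s" for k
    using that
  proof (induction k rule: less_induct)
    case (less k)
    define R where "R x = (\<Sum>j<s - k. Q (k + j) x * f l x ^ j)" for x
    have "f l x ^ k * R x = 0" if x: "x \<in> Z (Suc l)" for x
    proof -
      have "(\<Sum>j<s. Q j x * f l x ^ j) = (\<Sum>j<k. Q j x * f l x ^ j) + (\<Sum>j\<in>{k..<s}. Q j x * f l x ^ j)"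
        using less.prems sum.atLeastLessThan_concat[of 0 k s "\<lambda>j. Q j x * f l x ^ j"]
        by (simp add: atLeast0LessThan)
      also have "(\<Sum>j<k. Q j x * f l x ^ j) = 0"
      proof (rule sum.neutral, rule ballI)
        fix j assume "j \<in> {..<k}"
        hence "j < k" "j < s" using less.prems by auto
        hence "c (a(l := j)) = 0" if "a \<in> ?P" for a using less.IH[of j] that by blast
        hence "Q j x = (\<Sum>a\<in>?P. 0 * (\<Prod>i<l. f i x ^ a i))"
          unfolding Q_def by (intro sum.cong refl arg_cong2[where f = "(*)"])
        hence "Q j x = 0" by simp
        thus "Q j x * f l x ^ j = 0" by simp
      qed
      also have "(\<Sum>j\<in>{k..<s}. Q j x * f l x ^ j) = (\<Sum>j<s - k. Q (k + j) x * f l x ^ (k + j))"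
        by (rule sum.reindex_bij_witness[of _ "\<lambda>j. k + j" "\<lambda>j. j - k"]) auto
      also have "\<dots> = f l x ^ k * R x"
        by (simp add: R_def sum_distrib_left power_add mult_ac)
      finally show ?thesis using expand[OF x] by simp
    qed
    moreover have "R \<in> poly_funs C"
      unfolding R_def[abs_def] 
      by (intro poly_funs_sum poly_funs.mult Q poly_funs_power f(1)) simp
    ultimately have R0: "\<forall>x\<in>Z (Suc l). R x = 0" using cancel by blast
    have "Q k x = 0" if x: "x \<in> Z l" for x
    proof -
      have "R x = (\<Sum>j<s - k. if j = 0 then Q k x else 0)"
        unfolding R_def using f(2)[of l x] x by (intro sum.cong) auto
      also have "\<dots> = Q k x" using less.prems by (subst sum.delta) auto
      finally show ?thesis using R0 sub[of l] x by auto
    qed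
    hence zero': "\<And>x. x \<in> Z l \<Longrightarrow> (\<Sum>a\<in>?P. c (a(l := k)) * (\<Prod>i<l. f i x ^ a i)) = 0"
      by (simp add: Q_def)
    have "c (a(l := k)) = 0" if "a \<in> ?P" for a
      by (rule IH[where c = "\<lambda>a. c (a(l := k))", OF prime ne sub f zero' that])
        (assumption | simp)+
    thus ?case by blast
  qed
  obtain k a' where "k < s" "a' \<in> ?P" "a = a'(l := k)"
    using a PiE_insert_eq[of l "{..<l}" "\<lambda>_. {..<s}"] by (auto simp: lessThan_Suc)
  thus ?case using coeffs by blast
qed

text \<open>
  If all \<open>f\<^sub>i\<close> have exponents at most \<open>D\<close>, the \<open>s\<^sup>l\<close> monomials in \<open>f\<^sub>0, \<dots>, f\<^sub>l\<^sub>-\<^sub>1\<close> with exponents below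
  \<open>s\<close> lie in a space of dimension at most \<open>(l s D + 1)\<^sup>n\<close>.  For \<open>l > n\<close> and large \<open>s\<close> they would be
  linearly dependent.
\<close>
lemma chain_length_le:
  fixes Z :: "nat \<Rightarrow> 'k::field vec set"
  assumes prime: "\<And>i p q. i \<le> l \<Longrightarrow> p \<in> poly_funs (vec_coords n) \<Longrightarrow> q \<in> poly_funs (vec_coords n) \<Longrightarrow>
      (\<And>x. x \<in> Z i \<Longrightarrow> p x * q x = 0) \<Longrightarrow> (\<forall>x\<in>Z i. p x = 0) \<or> (\<forall>x\<in>Z i. q x = 0)"
    and ne: "Z 0 \<noteq> {}" and sub: "\<And>i. i < l \<Longrightarrow> Z i \<subseteq> Z (Suc i)"
    and f: "\<And>i. i < l \<Longrightarrow> f i \<in> poly_funs (vec_coords n)" "\<And>i x. i < l \<Longrightarrow> x \<in> Z i \<Longrightarrow> f i x = 0"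
      "\<And>i. i < l \<Longrightarrow> \<exists>x\<in>Z (Suc i). f i x \<noteq> 0"
  shows "l \<le> n"
proof (rule ccontr)
  assume "\<not> l \<le> n"
  have "\<exists>D. \<forall>i<l'. f i \<in> fun_span (vec_monoms n D)" if "l' \<le> l" for l'
    using that
  proof (induction l')
    case (Suc l')
    then obtain D E where "\<forall>i<l'. f i \<in> fun_span (vec_monoms n D)" "f l' \<in> fun_span (vec_monoms n E)"
      using poly_funs_bounded_degree[OF f(1)[of l']] by auto
    hence "\<forall>i<Suc l'. f i \<in> fun_span (vec_monoms n (max D E))"
      using fun_span_mono[OF vec_monoms_mono[of D "max D E" n]] fun_span_mono[OF vec_monoms_mono[of E "max D E" n]]
      by (auto simp: less_Suc_eq)
    thus ?case by blast
  qed simp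
  then obtain D where D: "\<And>i. i < l \<Longrightarrow> f i \<in> fun_span (vec_monoms n D)" by blast
  \<comment> \<open>Chosen so that \<open>(l s D + 1)\<^sup>n \<le> s\<^sup>n (l D + 1)\<^sup>n < s\<^sup>n\<^sup>+\<^sup>1\<close>.\<close>
  define s where "s = Suc (Suc (l * D) ^ n)"
  let ?P = "PiE {..<l} (\<lambda>_. {..<s})"
  have mem: "(\<lambda>x. \<Prod>i<l. f i x ^ a i) \<in> fun_span (vec_monoms n (l * (s * D)))" if a: "a \<in> ?P" for a
  proof (rule vec_monoms_prod)
    fix i assume i: "i < l"
    hence "a i < s" using a by (auto simp: PiE_def Pi_def)
    hence "a i * D \<le> s * D" by (intro mult_right_mono) auto
    thus "(\<lambda>x. f i x ^ a i) \<in> fun_span (vec_monoms n (s * D))"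
      using fun_span_mono[OF vec_monoms_mono] vec_monoms_power[OF D[OF i]] by blast
  qed
  have "card (vec_monoms n (l * (s * D)) :: ('k vec \<Rightarrow> 'k) set) \<le> Suc (l * (s * D)) ^ n"
    by (rule card_vec_monoms)
  also have "\<dots> \<le> (s * Suc (l * D)) ^ n"
    by (intro power_mono) (auto simp: s_def algebra_simps)
  also have "\<dots> = s ^ n * Suc (l * D) ^ n" by (rule power_mult_distrib)
  also have "\<dots> < s ^ n * s" by (intro mult_strict_left_mono) (auto simp: s_def)
  also have "s ^ n * s = s ^ Suc n" by simp
  also have "\<dots> \<le> s ^ l" by (rule power_increasing) (use \<open>\<not> l \<le> n\<close> in \<open>auto simp: s_def\<close>)
  also have "s ^ l = card ?P" by (simp add: card_PiE)
  finally have less: "card (vec_monoms n (l * (s * D)) :: ('k vec \<Rightarrow> 'k) set) < card ?P" .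
  have fin: "finite ?P" by (intro finite_PiE) auto
  have "\<exists>c. (\<exists>a\<in>?P. c a \<noteq> 0) \<and> (\<forall>x. (\<Sum>a\<in>?P. c a * (\<Prod>i<l. f i x ^ a i)) = 0)"
    by (rule fun_span_dependent[where f = "\<lambda>a x. \<Prod>i<l. f i x ^ a i",
          OF finite_vec_monoms fin less mem]) blast+
  then obtain c a where ca: "a \<in> ?P" "c a \<noteq> 0"
    "\<And>x. (\<Sum>a\<in>?P. c a * (\<Prod>i<l. f i x ^ a i)) = 0" by blast
  have "c a = 0"
    by (rule chain_independent[of l "vec_coords n" Z f c s, OF prime ne sub f ca(3) ca(1)])
  thus False using ca(2) by blast
qed

lemma irreducible_in_closure:
  assumes "irreducible_in T A"
  shows "irreducible_in T (T closure_of A)"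
proof -
  have A: "A \<subseteq> topspace T" "A \<noteq> {}" 
    "\<And>B C. closedin T B \<Longrightarrow> closedin T C \<Longrightarrow> A \<subseteq> B \<union> C \<Longrightarrow> A \<subseteq> B \<or> A \<subseteq> C"
    using assms unfolding irreducible_in_def by auto
  have sub: "A \<subseteq> T closure_of A" using A(1) by (rule closure_of_subset)
  show ?thesis unfolding irreducible_in_def
  proof (intro conjI allI impI)
    show "T closure_of A \<subseteq> topspace T" by (rule closure_of_subset_topspace)
    show "T closure_of A \<noteq> {}" using sub A(2) by blast
    fix B C assume BC: "closedin T B" "closedin T C" "T closure_of A \<subseteq> B \<union> C"
    hence "A \<subseteq> B \<or> A \<subseteq> C" using A(3) sub by blast
    thus "T closure_of A \<subseteq> B \<or> T closure_of A \<subseteq> C" using closure_of_minimal BC by metis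
  qed
qed

lemma irreducible_in_subtopology:
  assumes "irreducible_in (subtopology T Y) A"
  shows "irreducible_in T A"
  unfolding irreducible_in_def
proof (intro conjI allI impI)
  show "A \<subseteq> topspace T" "A \<noteq> {}" using assms unfolding irreducible_in_def by auto
  fix B C assume BC: "closedin T B" "closedin T C" "A \<subseteq> B \<union> C"
  have "A \<subseteq> Y" using assms unfolding irreducible_in_def by auto
  moreover have "closedin (subtopology T Y) (Y \<inter> B)" "closedin (subtopology T Y) (Y \<inter> C)"
    using BC by (auto intro: closedin_subtopology_Int_closed)
  ultimately have "A \<subseteq> Y \<inter> B \<or> A \<subseteq> Y \<inter> C" using assms BC(3)
    unfolding irreducible_in_def by (metis Int_Un_distrib le_inf_iff)
  thus "A \<subseteq> B \<or> A \<subseteq> C" by blast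
qed

text \<open>
  Taking closures embeds chains of \<open>Y\<close> into chains of the whole space; a set \<open>C\<close> closed in \<open>Y\<close> is
  recovered from its closure as the intersection with \<open>Y\<close>, so strictness survives.
\<close>
lemma krull_dim_subtopology_le: "krull_dim (subtopology T Y) \<le> krull_dim T"
proof -
  have "enat l \<le> krull_dim T" if
    C: "\<forall>i\<le>l. closedin (subtopology T Y) (C i) \<and> irreducible_in (subtopology T Y) (C i)" "\<forall>i<l. C i \<subset> C (Suc i)" for C l
  proof -
    define D where "D i = T closure_of (C i)" for i
    have CD: "C i = Y \<inter> D i" if i: "i \<le> l" for i
    proof -
      obtain E where E: "closedin T E" "C i = E \<inter> Y" using C(1) i by (auto simp: closedin_subtopology)
      hence "D i \<subseteq> E" unfolding D_def by (intro closure_of_minimal) auto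
      moreover have "C i \<subseteq> D i" unfolding D_def
        using E closedin_subset by (intro closure_of_subset) blast
      ultimately show ?thesis using E(2) by blast
    qed
    have irr: "irreducible_in T (D i)" if "i \<le> l" for i
      using C(1) that irreducible_in_closure irreducible_in_subtopology unfolding D_def by blast
    have "D i \<subset> D (Suc i)" if i: "i < l" for i
    proof -
      have "D i \<subseteq> D (Suc i)" unfolding D_def using C(2) i by (intro closure_of_mono) auto
      moreover have "D i \<noteq> D (Suc i)" using CD[of i] CD[of "Suc i"] C(2) i by auto
      ultimately show ?thesis by blast
    qed
    hence "\<exists>C. (\<forall>i\<le>l. closedin T (C i) \<and> irreducible_in T (C i)) \<and> (\<forall>i<l. C i \<subset> C (Suc i))"
      using irr by (intro exI[of _ D]) (auto simp: D_def)
    thus ?thesis unfolding krull_dim_def by (intro Sup_upper) blast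
  qed
  thus ?thesis unfolding krull_dim_def[of "subtopology T Y"] by (intro Sup_least) blast
qed

lemma variety_dim_mono:
  assumes "Y \<subseteq> X" shows "variety_dim n Y \<le> variety_dim n X"
proof -
  have "subtopology (zariski n) Y = subtopology (subtopology (zariski n) X) Y"
    using assms by (simp add: subtopology_subtopology Int_absorb1)
  thus ?thesis unfolding variety_dim_def by (metis krull_dim_subtopology_le)
qed

lemma irreducible_zariski_prime:
  assumes "irreducible_in (zariski n) Z" "p \<in> poly_funs (vec_coords n)" "q \<in> poly_funs (vec_coords n)"
    and "\<And>x. x \<in> Z \<Longrightarrow> p x * q x = 0"
  shows "(\<forall>x\<in>Z. p x = 0) \<or> (\<forall>x\<in>Z. q x = 0)"
proof -
  have cl: "closedin (zariski n) (zero_locus n {p})" if "p \<in> poly_funs (vec_coords n)" for p :: "'a vec \<Rightarrow> 'a"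
    unfolding closedin_zariski affine_variety_def using that by blast
  have "Z \<subseteq> carrier_vec n" using assms(1) by (simp add: irreducible_in_def topspace_zariski)
  hence "Z \<subseteq> zero_locus n {p} \<union> zero_locus n {q}" using assms(4) by (auto simp: zero_locus_def)
  hence "Z \<subseteq> zero_locus n {p} \<or> Z \<subseteq> zero_locus n {q}"
    using assms(1) cl[OF assms(2)] cl[OF assms(3)] unfolding irreducible_in_def by blast
  thus ?thesis by (auto simp: zero_locus_def)
qed

theorem variety_dim_le: "variety_dim n (Y :: 'k::field vec set) \<le> enat n"
proof -
  have "l \<le> n" if
    C: "\<forall>i\<le>l. closedin (zariski n) (C i) \<and> irreducible_in (zariski n) (C i)" "\<forall>i<l. C i \<subset> C (Suc i)"
    for l and C :: "nat \<Rightarrow> 'k vec set"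
  proof -
    have "\<forall>i. \<exists>f. i < l \<longrightarrow> f \<in> poly_funs (vec_coords n) \<and> (\<forall>x\<in>C i. f x = 0) \<and> (\<exists>x\<in>C (Suc i). f x \<noteq> 0)"
    proof
      fix i show "\<exists>f. i < l \<longrightarrow> f \<in> poly_funs (vec_coords n) \<and> (\<forall>x\<in>C i. f x = 0) \<and> (\<exists>x\<in>C (Suc i). f x \<noteq> 0)"
      proof (cases "i < l")
        case True
        then obtain x where x: "x \<in> C (Suc i)" "x \<notin> C i" using C(2) by blast
        have "closedin (zariski n) (C i)" "x \<in> carrier_vec n"
          using True C(1) x(1) closedin_subset[of "zariski n" "C (Suc i)"]
          by (auto simp: topspace_zariski)
        then obtain S where "S \<subseteq> poly_funs (vec_coords n)" "C i = zero_locus n S" "x \<in> carrier_vec n"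
          unfolding closedin_zariski affine_variety_def by blast
        thus ?thesis using x by (fastforce simp: zero_locus_def)
      qed auto
    qed
    then obtain f where f: "\<And>i. i < l \<Longrightarrow> f i \<in> poly_funs (vec_coords n)"
      "\<And>i x. i < l \<Longrightarrow> x \<in> C i \<Longrightarrow> f i x = 0" "\<And>i. i < l \<Longrightarrow> \<exists>x\<in>C (Suc i). f i x \<noteq> 0" by metis
    show ?thesis
    proof (rule chain_length_le[of l n C f])
      fix i p q assume "i \<le> l" "p \<in> poly_funs (vec_coords n)" "q \<in> poly_funs (vec_coords n)"
        "\<And>x. x \<in> C i \<Longrightarrow> p x * q x = 0"
      thus "(\<forall>x\<in>C i. p x = 0) \<or> (\<forall>x\<in>C i. q x = 0)"
        using irreducible_zariski_prime C(1) by blast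
    next
      show "C 0 \<noteq> {}" using C(1) by (auto simp: irreducible_in_def)
      show "C i \<subseteq> C (Suc i)" if "i < l" for i using C(2) that by blast
    qed (use f in auto)
  qed
  hence "krull_dim (zariski n :: 'k vec topology) \<le> enat n"
    unfolding krull_dim_def by (intro Sup_least) auto
  thus ?thesis unfolding variety_dim_def using krull_dim_subtopology_le order_trans by blast
qed

section \<open>Traces and nilpotent matrices\<close>

definition mtrace :: "'a::comm_ring_1 mat \<Rightarrow> 'a" where
  "mtrace A = (\<Sum>i<dim_row A. A $$ (i, i))"

lemma mtrace_add:
  "A \<in> carrier_mat m m \<Longrightarrow> B \<in> carrier_mat m m \<Longrightarrow> mtrace (A + B) = mtrace A + mtrace B"
  by (simp add: mtrace_def sum.distrib)

lemma mtrace_smult: "A \<in> carrier_mat m m \<Longrightarrow> mtrace (c \<cdot>\<^sub>m A) = c * mtrace A"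
  by (simp add: mtrace_def sum_distrib_left)

lemma mtrace_one: "mtrace (1\<^sub>m m) = of_nat m"
  by (simp add: mtrace_def)

lemma one_smult_mat: "1 \<cdot>\<^sub>m A = (A :: 'a::comm_ring_1 mat)"
  by (intro eq_matI) auto

lemma zero_mat_mult_vec: "v \<in> carrier_vec n \<Longrightarrow> 0\<^sub>m m n *\<^sub>v v = 0\<^sub>v m"
  by (intro eq_vecI) (auto simp: scalar_prod_def)

lemma zero_smult_add:
  "A \<in> carrier_mat m m \<Longrightarrow> 0 \<cdot>\<^sub>m 1\<^sub>m m + A = (A :: 'a::comm_ring_1 mat)"
  by (intro eq_matI) auto

lemma pow_mat_Suc_left:
  assumes "A \<in> carrier_mat m m" shows "A * A ^\<^sub>m k = A ^\<^sub>m Suc k"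
proof (induction k)
  case (Suc k)
  have "A * A ^\<^sub>m Suc k = (A * A ^\<^sub>m k) * A"
    using assms by (simp add: assoc_mult_mat[of _ m m _ m _ m])
  thus ?case using Suc assms by simp
qed (use assms in simp)

text \<open>
  The coefficients of the equation \<open>(x - A) adj (x - A) = \<chi>(x)\<close> between polynomials with matrix
  coefficients.  The trace of \<open>adj (x - A)\<close> is the derivative of \<open>\<chi>\<close>, which gives the second
  property.  Together these are Newton's identities between the traces of the powers of \<open>A\<close> and
  the coefficients of \<open>\<chi>\<close>, in a form that also contains the theorem of Cayley and Hamilton.
\<close>
lemma char_poly_adjugate_coeffs:
  fixes A :: "'a::idom mat"
  assumes A: "A \<in> carrier_mat m m"
  obtains B :: "nat \<Rightarrow> 'a mat" where
    "\<And>k. B k \<in> carrier_mat m m"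
    "\<And>k. mtrace (B k) = of_nat (Suc k) * coeff (char_poly A) (Suc k)"
    "\<And>k. B k = coeff (char_poly A) (Suc k) \<cdot>\<^sub>m 1\<^sub>m m + A * B (Suc k)"
    "0\<^sub>m m m = coeff (char_poly A) 0 \<cdot>\<^sub>m 1\<^sub>m m + A * B 0"
    "\<And>k. k \<ge> m \<Longrightarrow> B k = 0\<^sub>m m m"
proof -
  define M where "M = char_poly_matrix A"
  have M: "M \<in> carrier_mat m m" using A by (simp add: M_def)
  have adj: "adj_mat M \<in> carrier_mat m m" "M * adj_mat M = det M \<cdot>\<^sub>m 1\<^sub>m m"
    using adj_mat[OF M] by auto
  define B where "B k = map_mat (\<lambda>p. coeff p k) (adj_mat M)" for k
  have B: "B k \<in> carrier_mat m m" for k using adj by (simp add: B_def)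
  have dimB [simp]: "dim_row (B k) = m" "dim_col (B k) = m" for k using B[of k] by auto
  have entry: "(\<Sum>l<m. M $$ (i,l) * adj_mat M $$ (l,j)) = (if i = j then char_poly A else 0)"
    if "i < m" "j < m" for i j
  proof -
    have "(M * adj_mat M) $$ (i,j) = (\<Sum>l<m. M $$ (i,l) * adj_mat M $$ (l,j))"
      using that M adj(1) by (simp add: scalar_prod_def atLeast0LessThan)
    moreover have "(M * adj_mat M) $$ (i,j) = (if i = j then char_poly A else 0)"
      unfolding adj(2) using that by (simp add: char_poly_def M_def)
    ultimately show ?thesis by simp
  qed
  have Mentry: "M $$ (i,l) = (if i = l then [:0,1:] else 0) + [:- A $$ (i,l):]"
    if "i < m" "l < m" for i l
    using that A by (simp add: M_def char_poly_matrix_def)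
  have rec: "[:0,1:] * adj_mat M $$ (i,j) - (\<Sum>l<m. smult (A $$ (i,l)) (adj_mat M $$ (l,j)))
      = (if i = j then char_poly A else 0)" if "i < m" "j < m" for i j
  proof -
    have "(\<Sum>l<m. M $$ (i,l) * adj_mat M $$ (l,j)) = 
      (\<Sum>l<m. (if i = l then [:0,1:] else 0) * adj_mat M $$ (l,j)
         - smult (A $$ (i,l)) (adj_mat M $$ (l,j)))"
      using that by (intro sum.cong refl) (auto simp: Mentry algebra_simps)
    also have "\<dots> = (\<Sum>l<m. (if i = l then [:0,1:] else 0) * adj_mat M $$ (l,j))
         - (\<Sum>l<m. smult (A $$ (i,l)) (adj_mat M $$ (l,j)))"
      by (simp add: sum_subtractf)
    also have "(\<Sum>l<m. (if i = l then [:0,1:] else 0) * adj_mat M $$ (l,j))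
        = (\<Sum>l<m. if i = l then [:0,1:] * adj_mat M $$ (l,j) else 0)"
      by (intro sum.cong) auto
    also have "\<dots> = [:0,1:] * adj_mat M $$ (i,j)"
      using that by (subst sum.delta') auto
    finally show ?thesis using entry[OF that] by simp
  qed
  have AB: "(A * B k) $$ (i,j) = (\<Sum>l<m. A $$ (i,l) * B k $$ (l,j))" if "i < m" "j < m" for i j k
    using that A B[of k] by (simp add: scalar_prod_def atLeast0LessThan)
  have ABc: "(A * B k) $$ (i,j) = coeff (\<Sum>l<m. smult (A $$ (i,l)) (adj_mat M $$ (l,j))) k"
    if "i < m" "j < m" for i j k
    unfolding AB[OF that] using that adj(1) by (simp add: coeff_sum B_def)
  show ?thesis
  proof
    show "B k \<in> carrier_mat m m" for k by (rule B)
    show stepB: "B k = coeff (char_poly A) (Suc k) \<cdot>\<^sub>m 1\<^sub>m m + A * B (Suc k)" for k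
    proof (rule eq_matI)
      fix i j assume "i < dim_row (coeff (char_poly A) (Suc k) \<cdot>\<^sub>m 1\<^sub>m m + A * B (Suc k))"
        "j < dim_col (coeff (char_poly A) (Suc k) \<cdot>\<^sub>m 1\<^sub>m m + A * B (Suc k))"
      hence ij: "i < m" "j < m" using A B[of "Suc k"] by auto
      have "coeff ([:0,1:] * adj_mat M $$ (i,j)
          - (\<Sum>l<m. smult (A $$ (i,l)) (adj_mat M $$ (l,j)))) (Suc k)
        = coeff (if i = j then char_poly A else 0) (Suc k)"
        using rec[OF ij] by simp
      hence "B k $$ (i,j) - (A * B (Suc k)) $$ (i,j) = (if i = j then coeff (char_poly A) (Suc k) else 0)"
        unfolding ABc[OF ij] using ij adj(1) by (simp add: B_def)
      thus "B k $$ (i,j) = (coeff (char_poly A) (Suc k) \<cdot>\<^sub>m 1\<^sub>m m + A * B (Suc k)) $$ (i,j)"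
        using ij A B[of "Suc k"] by (simp add: algebra_simps del: index_mult_mat(1))
    qed (use A B in auto)
    show "0\<^sub>m m m = coeff (char_poly A) 0 \<cdot>\<^sub>m 1\<^sub>m m + A * B 0"
    proof (rule eq_matI)
      fix i j assume "i < dim_row (coeff (char_poly A) 0 \<cdot>\<^sub>m 1\<^sub>m m + A * B 0)"
        "j < dim_col (coeff (char_poly A) 0 \<cdot>\<^sub>m 1\<^sub>m m + A * B 0)"
      hence ij: "i < m" "j < m" using A B[of 0] by auto
      have "coeff ([:0,1:] * adj_mat M $$ (i,j)
          - (\<Sum>l<m. smult (A $$ (i,l)) (adj_mat M $$ (l,j)))) 0
        = coeff (if i = j then char_poly A else 0) 0"
        using rec[OF ij] by simp
      hence "- (A * B 0) $$ (i,j) = (if i = j then coeff (char_poly A) 0 else 0)"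
        unfolding ABc[OF ij] by simp
      hence "(A * B 0) $$ (i,j) = - (if i = j then coeff (char_poly A) 0 else 0)"
        by (metis minus_minus)
      thus "0\<^sub>m m m $$ (i,j) = (coeff (char_poly A) 0 \<cdot>\<^sub>m 1\<^sub>m m + A * B 0) $$ (i,j)"
        using ij A B[of 0] by (simp del: index_mult_mat(1))
    qed (use A B in auto)
    show "mtrace (B k) = of_nat (Suc k) * coeff (char_poly A) (Suc k)" for k
    proof -
      have "adj_mat M $$ (i,i) = char_poly (mat_delete A i i)" if i: "i < m" for i
      proof -
        have "adj_mat M $$ (i,i) = det (mat_delete M i i)"
          using that M by (simp add: adj_mat_def cofactor_def)
        also have "mat_delete M i i = char_poly_matrix (mat_delete A i i)"
          using A that unfolding M_def char_poly_matrix_def mat_delete_def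
          by (intro eq_matI) auto
        finally show ?thesis by (simp add: char_poly_def)
      qed
      hence "mtrace (B k) = coeff (\<Sum>i<m. char_poly (mat_delete A i i)) k"
        using adj(1) by (simp add: mtrace_def B_def coeff_sum)
      also have "\<dots> = coeff (pderiv (char_poly A)) k"
        using pderiv_char_poly[OF A] by simp
      finally show ?thesis by (simp add: coeff_pderiv)
    qed
    show "B k = 0\<^sub>m m m" if "k \<ge> m" for k
    proof -
      obtain K where K: "\<And>i j. i < m \<Longrightarrow> j < m \<Longrightarrow> degree (adj_mat M $$ (i,j)) < K"
      proof
        fix i j assume "i < m" "j < m"
        hence "degree (adj_mat M $$ (i,j)) \<le> Max ((\<lambda>(i,j). degree (adj_mat M $$ (i,j))) ` ({..<m}\<times>{..<m}))"
          by (intro Max_ge) auto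
        thus "degree (adj_mat M $$ (i,j)) < Suc (Max ((\<lambda>(i,j). degree (adj_mat M $$ (i,j))) ` ({..<m}\<times>{..<m})))"
          by simp
      qed
      have big: "B k = 0\<^sub>m m m" if "k \<ge> K" for k
      proof (rule eq_matI)
        fix i j assume "i < dim_row (0\<^sub>m m m)" "j < dim_col (0\<^sub>m m m)"
        hence "i < m" "j < m" by auto
        thus "B k $$ (i,j) = 0\<^sub>m m m $$ (i,j)" 
          using adj(1) K[of i j] that by (simp add: B_def coeff_eq_0)
      qed (use B[of k] in auto)
      show ?thesis
      proof (rule inc_induct[of k "max k K" "\<lambda>k. B k = 0\<^sub>m m m"])
        show "B (max k K) = 0\<^sub>m m m" by (rule big) simp
        fix l assume l: "k \<le> l" "B (Suc l) = 0\<^sub>m m m"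
        have "coeff (char_poly A) (Suc l) = 0"
          using degree_monic_char_poly[OF A] l(1) \<open>k \<ge> m\<close> by (intro coeff_eq_0) auto
        thus "B l = 0\<^sub>m m m"
          using stepB[of l] l(2) A zero_smult_add[of "0\<^sub>m m m :: 'a mat" m] by simp
      qed simp
    qed
  qed
qed

text \<open>
  Taking traces in the recursion for the coefficients \<open>B k\<close> of the adjugate yields
  \<open>(k + 1) c = m c\<close> for the coefficient \<open>c\<close> of \<open>\<chi>\<close> of degree \<open>k + 1 < m\<close>.  In characteristic zero
  all lower coefficients therefore vanish, and the recursion collapses to \<open>B 0 = A\<^sup>m\<^sup>-\<^sup>1\<close> and
  \<open>0 = A B 0\<close>.
\<close>
lemma mtrace_powers_zero_imp_nilpotent:
  fixes A :: "'a::field_char_0 mat"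
  assumes A: "A \<in> carrier_mat m m" and tr: "\<And>k. k > 0 \<Longrightarrow> mtrace (A ^\<^sub>m k) = 0"
  shows "A ^\<^sub>m m = 0\<^sub>m m m"
proof (cases "m = 0")
  case True
  thus ?thesis using A by (intro eq_matI) auto
next
  case False
  obtain B where B: "\<And>k. B k \<in> carrier_mat m m"
    "\<And>k. mtrace (B k) = of_nat (Suc k) * coeff (char_poly A) (Suc k)"
    "\<And>k. B k = coeff (char_poly A) (Suc k) \<cdot>\<^sub>m 1\<^sub>m m + A * B (Suc k)"
    "0\<^sub>m m m = coeff (char_poly A) 0 \<cdot>\<^sub>m 1\<^sub>m m + A * B 0"
    "\<And>k. k \<ge> m \<Longrightarrow> B k = 0\<^sub>m m m"
    using char_poly_adjugate_coeffs[OF A] by blast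
  have pow: "B (m - Suc i) = A ^\<^sub>m i" if "i < m" for i
    using that
  proof (induction i)
    case 0
    have "B (m - 1) = coeff (char_poly A) m \<cdot>\<^sub>m 1\<^sub>m m + A * 0\<^sub>m m m"
      using B(3)[of "m - 1"] B(5)[of m] False by simp
    thus ?case using degree_monic_char_poly[OF A] A by (simp add: one_smult_mat)
  next
    case (Suc i)
    define k where "k = m - Suc (Suc i)"
    have k: "Suc k = m - Suc i" using Suc.prems by (simp add: k_def)
    have eq: "B k = coeff (char_poly A) (Suc k) \<cdot>\<^sub>m 1\<^sub>m m + A ^\<^sub>m Suc i"
      using B(3)[of k] Suc k pow_mat_Suc_left[OF A, of i] by simp
    have "of_nat (Suc k) * coeff (char_poly A) (Suc k) = coeff (char_poly A) (Suc k) * (of_nat m :: 'a)"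
      using B(2)[of k] tr[of "Suc i"] A unfolding eq
      by (auto simp: mtrace_add[of _ m] mtrace_smult[of _ m] mtrace_one simp del: pow_mat.simps)
    hence "(of_nat m - of_nat (Suc k)) * coeff (char_poly A) (Suc k) = 0"
      by (auto simp: algebra_simps)
    moreover have "(of_nat m :: 'a) \<noteq> of_nat (Suc k)"
      using k Suc.prems by (subst of_nat_eq_iff) simp
    ultimately have "coeff (char_poly A) (Suc k) = 0" by (metis mult_eq_0_iff right_minus_eq)
    thus ?case using eq A zero_smult_add[of "A ^\<^sub>m Suc i" m]
      by (simp add: k_def del: pow_mat.simps)
  qed
  have "B 0 = A ^\<^sub>m (m - 1)" using pow[of "m - 1"] False by simp
  hence eq: "0\<^sub>m m m = coeff (char_poly A) 0 \<cdot>\<^sub>m 1\<^sub>m m + A ^\<^sub>m m"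
    using B(4) pow_mat_Suc_left[OF A, of "m - 1"] False by simp
  have "mtrace (0\<^sub>m m m :: 'a mat) = coeff (char_poly A) 0 * of_nat m"
    unfolding eq using tr[of m] A False
    by (simp add: mtrace_add[of _ m] mtrace_smult[of _ m] mtrace_one)
  hence "coeff (char_poly A) 0 = 0" using False by (simp add: mtrace_def)
  thus ?thesis using eq A by (simp add: zero_smult_add)
qed

text \<open>Zero is the only eigenvalue, and over an algebraically closed field the roots determine the polynomial.\<close>
lemma nilpotent_imp_char_poly:
  fixes A :: "'a::alg_closed_field mat"
  assumes A: "A \<in> carrier_mat m m" and nil: "A ^\<^sub>m k = 0\<^sub>m m m"
  shows "char_poly A = monom 1 m"
proof -
  let ?p = "char_poly A"
  have root: "x = 0" if "poly ?p x = 0" for x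
  proof -
    obtain v where v: "eigenvector A v x"
      using \<open>poly ?p x = 0\<close> eigenvalue_root_char_poly[OF A] unfolding eigenvalue_def by auto
    hence v': "v \<in> carrier_vec m" "v \<noteq> 0\<^sub>v m" unfolding eigenvector_def using A by auto
    have "0\<^sub>m m m *\<^sub>v v = x ^ k \<cdot>\<^sub>v v" using eigenvector_pow[OF A v, of k] nil by simp
    hence z: "x ^ k \<cdot>\<^sub>v v = 0\<^sub>v m" 
      using v' by (metis zero_mat_mult_vec)
    obtain i where "i < m" "v $ i \<noteq> 0" using v' by (metis carrier_vecD eq_vecI index_zero_vec)
    hence "x ^ k = 0" using arg_cong[OF z, of "\<lambda>w. w $ i"] v' by simp
    thus "x = 0" by simp
  qed
  have p: "degree ?p = m" "lead_coeff ?p = 1" using degree_monic_char_poly[OF A] by auto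
  hence "?p \<noteq> 0" by auto
  obtain q where q: "?p = [:-0, 1:] ^ order 0 ?p * q" "\<not> [:-0,1:] dvd q"
    using order_decomp[OF \<open>?p \<noteq> 0\<close>, of 0] by blast
  have "degree q = 0"
  proof (rule ccontr)
    assume "degree q \<noteq> 0"
    then obtain x where x: "poly q x = 0" using alg_closed_imp_poly_has_root[of q] by auto
    hence "poly ?p x = 0" by (subst q) simp
    hence "x = 0" by (rule root)
    thus False using x q(2) poly_eq_0_iff_dvd[of q 0] by simp
  qed
  then obtain c where "q = [:c:]" using degree_eq_zeroE by blast
  hence eq: "?p = monom c (order 0 ?p)"
    using q(1) by (simp add: monom_altdef)
  hence "c \<noteq> 0" using \<open>?p \<noteq> 0\<close> by auto
  hence "order 0 ?p = m" using p(1) eq by (metis degree_monom_eq)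
  thus ?thesis using eq p(2) by (metis lead_coeff_monom)
qed

lemma nilpotent_imp_mtrace_zero:
  fixes A :: "'a::alg_closed_field mat"
  assumes A: "A \<in> carrier_mat m m" and nil: "A ^\<^sub>m k = 0\<^sub>m m m"
  shows "mtrace A = 0"
proof -
  have chi: "coeff (char_poly A) i = (if i = m then 1 else 0)" for i
    unfolding nilpotent_imp_char_poly[OF assms] by simp
  obtain B where B: "\<And>k. B k \<in> carrier_mat m m"
    "\<And>k. mtrace (B k) = of_nat (Suc k) * coeff (char_poly A) (Suc k)"
    "\<And>k. B k = coeff (char_poly A) (Suc k) \<cdot>\<^sub>m 1\<^sub>m m + A * B (Suc k)"
    "0\<^sub>m m m = coeff (char_poly A) 0 \<cdot>\<^sub>m 1\<^sub>m m + A * B 0"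
    "\<And>k. k \<ge> m \<Longrightarrow> B k = 0\<^sub>m m m"
    using char_poly_adjugate_coeffs[OF A] by blast
  have top: "B (m - 1) = 1\<^sub>m m" if "m > 0"
    using B(3)[of "m - 1"] B(5)[of m] that chi A by (simp add: one_smult_mat)
  consider "m = 0" | "m = 1" | i where "m = Suc (Suc i)"
    by (metis One_nat_def old.nat.exhaust)
  thus ?thesis
  proof cases
    case 1 thus ?thesis using A by (simp add: mtrace_def)
  next
    case 2
    hence "0\<^sub>m m m = A" using B(4) top chi A by (simp add: zero_smult_add)
    hence "A = 0\<^sub>m m m" by simp
    thus ?thesis by (simp add: mtrace_def)
  next
    case 3
    hence "B i = A" using B(3)[of i] top chi A by (simp add: zero_smult_add)
    thus ?thesis using B(2)[of i] chi 3 by simp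
  qed
qed

section \<open>Kolchin's theorem\<close>

text \<open>
  The linear span of the matrices \<open>g - 1\<close>: for a group \<open>G\<close> this is the image of the augmentation ideal of
  its group algebra.
\<close>
inductive_set augmentation :: "nat \<Rightarrow> 'a::field mat set \<Rightarrow> 'a mat set" for m G where
  zero: "0\<^sub>m m m \<in> augmentation m G"
| add: "a \<in> augmentation m G \<Longrightarrow> g \<in> G \<Longrightarrow> a + c \<cdot>\<^sub>m (g - 1\<^sub>m m) \<in> augmentation m G"

definition vec_subspace :: "nat \<Rightarrow> 'a::field vec set \<Rightarrow> bool" where
  "vec_subspace m W \<longleftrightarrow> W \<subseteq> carrier_vec m \<and> 0\<^sub>v m \<in> W \<and>
     (\<forall>v\<in>W. \<forall>w\<in>W. v + w \<in> W) \<and> (\<forall>c. \<forall>v\<in>W. c \<cdot>\<^sub>v v \<in> W)"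

text \<open>
  The positions of the leading nonzero entries of vectors in a subspace.  Their number is the
  dimension; it serves as a bounded measure that grows strictly with the subspace.
\<close>
definition pivots :: "nat \<Rightarrow> 'a::field vec set \<Rightarrow> nat set" where
  "pivots m W = {i. i < m \<and> (\<exists>w\<in>W. w $ i \<noteq> 0 \<and> (\<forall>j<i. w $ j = 0))}"

lemma vec_subspaceD:
  assumes "vec_subspace m W"
  shows "W \<subseteq> carrier_vec m" "0\<^sub>v m \<in> W" "v \<in> W \<Longrightarrow> w \<in> W \<Longrightarrow> v + w \<in> W"
    "v \<in> W \<Longrightarrow> c \<cdot>\<^sub>v v \<in> W"
  using assms unfolding vec_subspace_def by auto

lemma finite_pivots: "finite (pivots m W)" and card_pivots_le: "card (pivots m W) \<le> m"
proof -
  have sub: "pivots m W \<subseteq> {..<m}" by (auto simp: pivots_def)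
  thus "finite (pivots m W)" by (rule finite_subset) simp
  show "card (pivots m W) \<le> m" using card_mono[OF _ sub] by simp
qed

lemma pivots_determine_subspace:
  assumes W: "vec_subspace m W" and W': "vec_subspace m W'" and sub: "W \<subseteq> W'" and piv: "pivots m W' \<subseteq> pivots m W"
  shows "W' = W"
proof -
  have "w \<in> W" if "w \<in> W'" "\<forall>j<m - d. w $ j = 0" for w d
    using that
  proof (induction d arbitrary: w)
    case 0
    hence "w = 0\<^sub>v m" using vec_subspaceD(1)[OF W'] by (intro eq_vecI) auto
    thus ?case using vec_subspaceD(2)[OF W] by simp
  next
    case (Suc d)
    show ?case
    proof (cases "\<forall>j<m - d. w $ j = 0")
      case True thus ?thesis using Suc by blast
    next
      case False
      define i where "i = m - Suc d"
      have i: "i < m" "w $ i \<noteq> 0" "\<And>j. j < m - d \<longleftrightarrow> j < i \<or> j = i"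
        using False Suc.prems(2) by (auto simp: i_def) (metis Suc_diff_Suc Suc_lessI diff_Suc_1 less_Suc_eq
            zero_less_diff linorder_not_le diff_is_0_eq' not_less_zero)+
      have "i \<in> pivots m W" using piv i Suc.prems by (auto simp: pivots_def i_def)
      then obtain u where u: "u \<in> W" "u $ i \<noteq> 0" "\<forall>j<i. u $ j = 0" by (auto simp: pivots_def)
      define c where "c = - (w $ i / u $ i)"
      have car: "u \<in> carrier_vec m" "w \<in> carrier_vec m"
        using u(1) Suc.prems(1) vec_subspaceD(1)[OF W'] sub by auto
      have "w + c \<cdot>\<^sub>v u \<in> W"
      proof (rule Suc.IH)
        show "w + c \<cdot>\<^sub>v u \<in> W'"
          using vec_subspaceD(3,4)[OF W'] Suc.prems(1) u(1) sub by blast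
        show "\<forall>j<m - d. (w + c \<cdot>\<^sub>v u) $ j = 0"
        proof (intro allI impI)
          fix j assume "j < m - d"
          hence "j < i \<or> j = i" using i(3) by blast
          thus "(w + c \<cdot>\<^sub>v u) $ j = 0"
            using car i(1) u(2,3) Suc.prems(2) by (auto simp: c_def i_def)
        qed
      qed
      hence "(w + c \<cdot>\<^sub>v u) + (- c) \<cdot>\<^sub>v u \<in> W" using vec_subspaceD(3,4)[OF W] u(1) by blast
      also have "(w + c \<cdot>\<^sub>v u) + (- c) \<cdot>\<^sub>v u = w" using car by (intro eq_vecI) auto
      finally show ?thesis .
    qed
  qed
  from this[of _ m] show ?thesis using sub by auto
qed

lemma card_pivots_less:
  assumes "vec_subspace m W" "vec_subspace m W'" "W \<subset> W'"
  shows "card (pivots m W) < card (pivots m W')"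
proof (rule psubset_card_mono[OF finite_pivots])
  have "pivots m W \<subseteq> pivots m W'" using assms(3) by (auto simp: pivots_def)
  moreover have "\<not> pivots m W' \<subseteq> pivots m W"
    using pivots_determine_subspace[OF assms(1,2)] assms(3) by blast
  ultimately show "pivots m W \<subset> pivots m W'" by blast
qed

text \<open>
  Choose \<open>w\<close> outside \<open>K\<close> with \<open>J w + K\<close> as small as possible.  If \<open>v = a w\<close> is not in \<open>K\<close> for some \<open>a\<close>
  in \<open>J\<close>, then \<open>J v + K = J w + K\<close> by minimality, so \<open>v = b v + k\<close> for some \<open>b\<close> in \<open>J\<close> and \<open>k\<close> in
  \<open>K\<close>.  Iterating, \<open>v\<close> is congruent to \<open>b\<^sup>m v = 0\<close> modulo \<open>K\<close>, a contradiction.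
\<close>
lemma nil_algebra_null_vector:
  fixes J :: "'a::field mat set"
  assumes J: "J \<subseteq> carrier_mat m m" "0\<^sub>m m m \<in> J" "\<And>a b. a \<in> J \<Longrightarrow> b \<in> J \<Longrightarrow> a + b \<in> J"
    "\<And>a c. a \<in> J \<Longrightarrow> c \<cdot>\<^sub>m a \<in> J" "\<And>a b. a \<in> J \<Longrightarrow> b \<in> J \<Longrightarrow> a * b \<in> J"
    and nil: "\<And>a. a \<in> J \<Longrightarrow> a ^\<^sub>m m = 0\<^sub>m m m"
    and K: "vec_subspace m K" "\<And>a k. a \<in> J \<Longrightarrow> k \<in> K \<Longrightarrow> a *\<^sub>v k \<in> K" "K \<noteq> carrier_vec m"
  obtains w where "w \<in> carrier_vec m" "w \<notin> K" "\<And>a. a \<in> J \<Longrightarrow> a *\<^sub>v w \<in> K"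
proof (rule ccontr)
  note found = that
  assume neg: "\<not> thesis"
  have ex: "\<exists>a\<in>J. a *\<^sub>v w \<notin> K" if "w \<in> carrier_vec m" "w \<notin> K" for w
    using that found neg by blast
  define M where "M w = {a *\<^sub>v w + k | a k. a \<in> J \<and> k \<in> K}" for w
  have Kc: "K \<subseteq> carrier_vec m" using vec_subspaceD(1)[OF K(1)] .
  have car: "a *\<^sub>v w \<in> carrier_vec m" if "a \<in> J" "w \<in> carrier_vec m" for a w
    using J(1) that by (auto intro: mult_mat_vec_carrier)
  have M: "vec_subspace m (M w)" if w: "w \<in> carrier_vec m" for w
    unfolding vec_subspace_def
  proof (intro conjI ballI allI)
    show "M w \<subseteq> carrier_vec m" using car[OF _ w] Kc by (auto simp: M_def)
    have "0\<^sub>v m = 0\<^sub>m m m *\<^sub>v w + 0\<^sub>v m" using w by (simp add: zero_mat_mult_vec)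
    thus "0\<^sub>v m \<in> M w" unfolding M_def using J(2) vec_subspaceD(2)[OF K(1)] by blast
  next
    fix x y assume "x \<in> M w" "y \<in> M w"
    then obtain a k b l where ab: "a \<in> J" "k \<in> K" "x = a *\<^sub>v w + k" "b \<in> J" "l \<in> K" "y = b *\<^sub>v w + l"
      by (auto simp: M_def)
    have "a \<in> carrier_mat m m" "b \<in> carrier_mat m m" "k \<in> carrier_vec m" "l \<in> carrier_vec m"
      using ab J(1) Kc by auto
    hence "x + y = (a + b) *\<^sub>v w + (k + l)"
      unfolding ab using w by (intro eq_vecI) (auto simp: add_mult_distrib_mat_vec[of _ m m])
    thus "x + y \<in> M w" unfolding M_def using ab J(3) vec_subspaceD(3)[OF K(1)] by blast
  next
    fix c x assume "x \<in> M w"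
    then obtain a k where ab: "a \<in> J" "k \<in> K" "x = a *\<^sub>v w + k"
      by (auto simp: M_def)
    have "a \<in> carrier_mat m m" "k \<in> carrier_vec m" using ab J(1) Kc by auto
    hence "c \<cdot>\<^sub>v x = (c \<cdot>\<^sub>m a) *\<^sub>v w + c \<cdot>\<^sub>v k"
      unfolding ab using w by (intro eq_vecI) (auto simp: algebra_simps)
    thus "c \<cdot>\<^sub>v x \<in> M w" unfolding M_def using ab J(4) vec_subspaceD(4)[OF K(1)] by blast
  qed
  have "\<exists>w. w \<in> carrier_vec m \<and> w \<notin> K" using K(3) Kc by blast
  then obtain w where w: "w \<in> carrier_vec m" "w \<notin> K"
    and least: "\<And>v. v \<in> carrier_vec m \<Longrightarrow> v \<notin> K \<Longrightarrow> card (pivots m (M w)) \<le> card (pivots m (M v))"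
    using ex_has_least_nat[of "\<lambda>w. w \<in> carrier_vec m \<and> w \<notin> K" _ "\<lambda>w. card (pivots m (M w))"] by blast
  obtain a where a: "a \<in> J" "a *\<^sub>v w \<notin> K" using ex[OF w] by blast
  define v where "v = a *\<^sub>v w"
  have v: "v \<in> carrier_vec m" "v \<notin> K" using a car w(1) by (auto simp: v_def)
  have "M v \<subseteq> M w"
  proof
    fix x assume "x \<in> M v"
    then obtain b k where b: "b \<in> J" "k \<in> K" "x = b *\<^sub>v v + k" by (auto simp: M_def)
    have "b *\<^sub>v v = (b * a) *\<^sub>v w" unfolding v_def using b(1) a(1) J(1) w(1)
      by (subst assoc_mult_mat_vec[of _ m m _ m]) auto
    thus "x \<in> M w" using b J(5)[OF b(1) a(1)] by (auto simp: M_def)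
  qed
  hence "M v = M w"
    using card_pivots_less[OF M[OF v(1)] M[OF w(1)]] least[OF v] by (meson leD psubsetI)
  moreover have "v \<in> M w"
    using a(1) vec_subspaceD(2)[OF K(1)] v(1) unfolding M_def v_def
    by (intro CollectI exI[of _ a] exI[of _ "0\<^sub>v m"]) auto
  ultimately have "v \<in> M v" by simp
  then obtain b k where b: "b \<in> J" "k \<in> K" "v = b *\<^sub>v v + k" unfolding M_def by blast
  have bc: "b \<in> carrier_mat m m" using b(1) J(1) by auto
  have "\<exists>l\<in>K. v = b ^\<^sub>m n *\<^sub>v v + l" for n
  proof (induction n)
    case 0
    have "v = b ^\<^sub>m 0 *\<^sub>v v + 0\<^sub>v m" using v(1) bc by simp
    thus ?case using vec_subspaceD(2)[OF K(1)] by blast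
  next
    case (Suc n)
    then obtain l where l: "l \<in> K" "v = b ^\<^sub>m n *\<^sub>v v + l" by blast
    have lc: "l \<in> carrier_vec m" "k \<in> carrier_vec m" using l(1) b(2) Kc by auto
    have bn: "b ^\<^sub>m n *\<^sub>v v \<in> carrier_vec m" using bc v(1) by (meson mult_mat_vec_carrier pow_carrier_mat)
    have "b *\<^sub>v v = b *\<^sub>v (b ^\<^sub>m n *\<^sub>v v) + b *\<^sub>v l"
      using l(2) mult_add_distrib_mat_vec[OF bc bn lc(1)] by simp
    also have "b *\<^sub>v (b ^\<^sub>m n *\<^sub>v v) = b ^\<^sub>m Suc n *\<^sub>v v"
      using bc v(1) pow_mat_Suc_left[OF bc, of n]
      by (metis assoc_mult_mat_vec pow_carrier_mat)
    finally have "v = (b ^\<^sub>m Suc n *\<^sub>v v + b *\<^sub>v l) + k" using b(3) by simp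
    also have "\<dots> = b ^\<^sub>m Suc n *\<^sub>v v + (b *\<^sub>v l + k)"
      using bc lc v(1) by (intro assoc_add_vec[of _ m]) (auto intro: mult_mat_vec_carrier pow_carrier_mat simp del: pow_mat.simps)
    finally show ?case using K(2)[OF b(1) l(1)] b(2) vec_subspaceD(3)[OF K(1)] by blast
  qed
  then obtain l where "l \<in> K" "v = b ^\<^sub>m m *\<^sub>v v + l" by blast
  hence "v = l" using nil[OF b(1)] v(1) Kc by (auto simp: zero_mat_mult_vec)
  thus False using v(2) \<open>l \<in> K\<close> by simp
qed

text \<open>Level \<open>i\<close> consists of the vectors killed by all products of \<open>i\<close> elements of \<open>J\<close>.\<close>
primrec null_filtration :: "nat \<Rightarrow> 'a::field mat set \<Rightarrow> nat \<Rightarrow> 'a vec set" where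
  "null_filtration m J 0 = {0\<^sub>v m}"
| "null_filtration m J (Suc i) = {v \<in> carrier_vec m. \<forall>a\<in>J. a *\<^sub>v v \<in> null_filtration m J i}"

text \<open>
  By the previous lemma each step of the filtration is strict until the whole space is reached, and
  the number of pivots, which grows with every strict step, is at most \<open>m\<close>.
\<close>
lemma nil_algebra_null_filtration:
  fixes J :: "'a::field mat set"
  assumes J: "J \<subseteq> carrier_mat m m" "0\<^sub>m m m \<in> J" "\<And>a b. a \<in> J \<Longrightarrow> b \<in> J \<Longrightarrow> a + b \<in> J"
    "\<And>a c. a \<in> J \<Longrightarrow> c \<cdot>\<^sub>m a \<in> J" "\<And>a b. a \<in> J \<Longrightarrow> b \<in> J \<Longrightarrow> a * b \<in> J"
    and nil: "\<And>a. a \<in> J \<Longrightarrow> a ^\<^sub>m m = 0\<^sub>m m m"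
  shows "null_filtration m J (Suc m) = carrier_vec m"
proof -
  let ?K = "null_filtration m J"
  have car: "a *\<^sub>v w \<in> carrier_vec m" if "a \<in> J" "w \<in> carrier_vec m" for a w
    using J(1) that by (auto intro: mult_mat_vec_carrier)
  have K: "vec_subspace m (?K i)" for i
  proof (induction i)
    case 0 thus ?case by (auto simp: vec_subspace_def)
  next
    case (Suc i)
    show ?case unfolding vec_subspace_def
    proof (intro conjI ballI allI)
      show "?K (Suc i) \<subseteq> carrier_vec m" by auto
      have "a *\<^sub>v 0\<^sub>v m = 0\<^sub>v m" if "a \<in> J" for a
        using J(1) that by (intro eq_vecI) auto
      thus "0\<^sub>v m \<in> ?K (Suc i)" using vec_subspaceD(2)[OF Suc] by auto
    next
      fix v w assume vw: "v \<in> ?K (Suc i)" "w \<in> ?K (Suc i)"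
      have "a *\<^sub>v (v + w) = a *\<^sub>v v + a *\<^sub>v w" if "a \<in> J" for a
        using that J(1) vw by (intro mult_add_distrib_mat_vec[of _ m m]) auto
      thus "v + w \<in> ?K (Suc i)" using vw vec_subspaceD(3)[OF Suc] by auto
    next
      fix c v assume v: "v \<in> ?K (Suc i)"
      have "a *\<^sub>v (c \<cdot>\<^sub>v v) = c \<cdot>\<^sub>v (a *\<^sub>v v)" if "a \<in> J" for a
        using that J(1) v by (intro mult_mat_vec[of _ m m]) auto
      thus "c \<cdot>\<^sub>v v \<in> ?K (Suc i)" using v vec_subspaceD(4)[OF Suc] by auto
    qed
  qed
  have stable: "a *\<^sub>v v \<in> ?K i" if "a \<in> J" "v \<in> ?K i" for a v i
    using that
  proof (induction i arbitrary: a v)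
    case 0 
    have "a *\<^sub>v 0\<^sub>v m = 0\<^sub>v m" using 0 J(1) by (intro eq_vecI) auto
    thus ?case using 0 by simp
  next
    case (Suc i)
    thus ?case using car by auto
  qed
  have mono: "?K i \<subseteq> ?K (Suc i)" for i
    using stable vec_subspaceD(1)[OF K[of i]] by auto
  have "?K i = carrier_vec m \<or> i \<le> card (pivots m (?K i))" for i
  proof (induction i)
    case (Suc i)
    show ?case
    proof (cases "?K i = carrier_vec m")
      case True thus ?thesis using mono[of i] vec_subspaceD(1)[OF K[of "Suc i"]] by blast
    next
      case False
      then obtain w where "w \<in> carrier_vec m" "w \<notin> ?K i" "\<And>a. a \<in> J \<Longrightarrow> a *\<^sub>v w \<in> ?K i"
        using nil_algebra_null_vector[OF J nil K[of i] stable] by blast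
      hence "?K i \<subset> ?K (Suc i)" using mono[of i] by auto
      hence "card (pivots m (?K i)) < card (pivots m (?K (Suc i)))"
        by (rule card_pivots_less[OF K K])
      thus ?thesis using Suc False by simp
    qed
  qed simp
  from this[of "Suc m"] show ?thesis using card_pivots_le[of m "?K (Suc m)"] by linarith
qed

primrec unipotent_products :: "nat \<Rightarrow> 'a::field mat set \<Rightarrow> nat \<Rightarrow> 'a mat set" where
  "unipotent_products m G 0 = {1\<^sub>m m}"
| "unipotent_products m G (Suc n) = {A * (g - 1\<^sub>m m) | A g. A \<in> unipotent_products m G n \<and> g \<in> G}"

locale unipotent_semigroup =
  fixes m :: nat and G :: "'a::{alg_closed_field, field_char_0} mat set"
  assumes carr: "g \<in> G \<Longrightarrow> g \<in> carrier_mat m m"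
    and mult: "g \<in> G \<Longrightarrow> h \<in> G \<Longrightarrow> g * h \<in> G"
    and unip: "g \<in> G \<Longrightarrow> unipotent_mat m g"
begin

lemma augmentation_carrier: "a \<in> augmentation m G \<Longrightarrow> a \<in> carrier_mat m m"
  by (induction rule: augmentation.induct) (use carr in auto)

lemma augmentation_add:
  assumes "a \<in> augmentation m G" "b \<in> augmentation m G"
  shows "a + b \<in> augmentation m G"
  using assms(2)
proof (induction rule: augmentation.induct)
  case zero thus ?case using assms(1) augmentation_carrier by simp
next
  case (add b g c)
  have "a + (b + c \<cdot>\<^sub>m (g - 1\<^sub>m m)) = (a + b) + c \<cdot>\<^sub>m (g - 1\<^sub>m m)"
    using assms(1) add augmentation_carrier carr by (intro assoc_add_mat[symmetric, of _ m m]) auto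
  thus ?case using augmentation.add[OF add.IH add.hyps(2)] by simp
qed

lemma augmentation_smult: "a \<in> augmentation m G \<Longrightarrow> d \<cdot>\<^sub>m a \<in> augmentation m G"
proof (induction rule: augmentation.induct)
  case zero
  have "d \<cdot>\<^sub>m 0\<^sub>m m m = (0\<^sub>m m m :: 'a mat)" by (intro eq_matI) auto
  thus ?case using augmentation.zero by simp
next
  case (add b g c)
  have "d \<cdot>\<^sub>m (b + c \<cdot>\<^sub>m (g - 1\<^sub>m m)) = d \<cdot>\<^sub>m b + (d * c) \<cdot>\<^sub>m (g - 1\<^sub>m m)"
    using add augmentation_carrier[of b] carr by (intro eq_matI) (auto simp: algebra_simps)
  thus ?case using augmentation.add[OF add.IH add.hyps(2)] by simp
qed

lemma diff_in_augmentation: "g \<in> G \<Longrightarrow> g - 1\<^sub>m m \<in> augmentation m G"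
proof -
  assume g: "g \<in> G"
  have "g - 1\<^sub>m m = 0\<^sub>m m m + 1 \<cdot>\<^sub>m (g - 1\<^sub>m m)" using carr[OF g] by (intro eq_matI) auto
  moreover have "0\<^sub>m m m + 1 \<cdot>\<^sub>m (g - 1\<^sub>m m) \<in> augmentation m G"
    by (intro augmentation.add augmentation.zero g)
  ultimately show ?thesis by simp
qed

text \<open>This rests on \<open>(g - 1) (h - 1) = (g h - 1) - (g - 1) - (h - 1)\<close>.\<close>
lemma augmentation_mult_generator:
  assumes "a \<in> augmentation m G" "h \<in> G"
  shows "a * (h - 1\<^sub>m m) \<in> augmentation m G"
  using assms(1)
proof (induction rule: augmentation.induct)
  case zero
  have "0\<^sub>m m m * (h - 1\<^sub>m m) = 0\<^sub>m m m" using carr[OF assms(2)] by auto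
  thus ?case using augmentation.zero by simp
next
  case (add b g c)
  have c: "b \<in> carrier_mat m m" "g \<in> carrier_mat m m" "h \<in> carrier_mat m m"
    "g - 1\<^sub>m m \<in> carrier_mat m m" "h - 1\<^sub>m m \<in> carrier_mat m m"
    using add.hyps assms(2) augmentation_carrier carr by auto
  have e1: "(g - 1\<^sub>m m) * (h - 1\<^sub>m m) = (g * h - 1\<^sub>m m) + ((-1) \<cdot>\<^sub>m (g - 1\<^sub>m m) + (-1) \<cdot>\<^sub>m (h - 1\<^sub>m m))"
  proof -
    have "(g - 1\<^sub>m m) * (h - 1\<^sub>m m) = g * h - g - (h - 1\<^sub>m m)"
      using c minus_mult_distrib_mat[of g m m "1\<^sub>m m" "h - 1\<^sub>m m" m] mult_minus_distrib_mat[of g m m h m "1\<^sub>m m"] by simp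
    also have "\<dots> = (g * h - 1\<^sub>m m) + ((-1) \<cdot>\<^sub>m (g - 1\<^sub>m m) + (-1) \<cdot>\<^sub>m (h - 1\<^sub>m m))"
      using c by (intro eq_matI) (auto simp del: index_mult_mat(1))
    finally show ?thesis .
  qed
  have "(g - 1\<^sub>m m) * (h - 1\<^sub>m m) \<in> augmentation m G"
    unfolding e1 using diff_in_augmentation mult add.hyps(2) assms(2)
    by (intro augmentation_add augmentation_smult) auto
  hence "b * (h - 1\<^sub>m m) + c \<cdot>\<^sub>m ((g - 1\<^sub>m m) * (h - 1\<^sub>m m)) \<in> augmentation m G"
    using add.IH by (intro augmentation_add augmentation_smult)
  also have "b * (h - 1\<^sub>m m) + c \<cdot>\<^sub>m ((g - 1\<^sub>m m) * (h - 1\<^sub>m m)) = (b + c \<cdot>\<^sub>m (g - 1\<^sub>m m)) * (h - 1\<^sub>m m)"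
    using c add_mult_distrib_mat[of b m m "c \<cdot>\<^sub>m (g - 1\<^sub>m m)" "h - 1\<^sub>m m" m]
      mult_smult_assoc_mat[of "g - 1\<^sub>m m" m m "h - 1\<^sub>m m" m c] by simp
  finally show ?case .
qed

lemma augmentation_mult:
  assumes "a \<in> augmentation m G" "b \<in> augmentation m G"
  shows "a * b \<in> augmentation m G"
  using assms(2)
proof (induction rule: augmentation.induct)
  case zero
  thus ?case using augmentation_carrier[OF assms(1)] augmentation.zero by simp
next
  case (add b g c)
  have c: "a \<in> carrier_mat m m" "b \<in> carrier_mat m m" "g \<in> carrier_mat m m"
    "g - 1\<^sub>m m \<in> carrier_mat m m"
    using add.hyps assms(1) augmentation_carrier carr by auto
  have "a * b + c \<cdot>\<^sub>m (a * (g - 1\<^sub>m m)) \<in> augmentation m G"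
    using add augmentation_mult_generator[OF assms(1)] by (intro augmentation_add augmentation_smult) auto
  also have "a * b + c \<cdot>\<^sub>m (a * (g - 1\<^sub>m m)) = a * (b + c \<cdot>\<^sub>m (g - 1\<^sub>m m))"
    using c mult_add_distrib_mat[of a m m b m "c \<cdot>\<^sub>m (g - 1\<^sub>m m)"]
      mult_smult_distrib[of a m m "g - 1\<^sub>m m" m c] by simp
  finally show ?case .
qed

lemma augmentation_mtrace: "a \<in> augmentation m G \<Longrightarrow> mtrace a = 0"
proof (induction rule: augmentation.induct)
  case zero thus ?case by (simp add: mtrace_def)
next
  case (add a g c)
  have c: "a \<in> carrier_mat m m" "g - 1\<^sub>m m \<in> carrier_mat m m"
    using add.hyps augmentation_carrier carr by auto
  obtain k where "(g - 1\<^sub>m m) ^\<^sub>m k = 0\<^sub>m m m"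
    using unip[OF add.hyps(2)] by (auto simp: unipotent_mat_def)
  hence "mtrace (g - 1\<^sub>m m) = 0" by (rule nilpotent_imp_mtrace_zero[OF c(2)])
  thus ?case using c add.IH by (simp add: mtrace_add[of _ m] mtrace_smult[of _ m])
qed

lemma augmentation_nilpotent: 
  assumes "a \<in> augmentation m G"
  shows "a ^\<^sub>m m = 0\<^sub>m m m"
proof (rule mtrace_powers_zero_imp_nilpotent)
  show c: "a \<in> carrier_mat m m" by (rule augmentation_carrier[OF assms])
  fix k :: nat assume "k > 0"
  have "a ^\<^sub>m Suc l \<in> augmentation m G" for l
    by (induction l) (use assms c augmentation_mult in auto)
  from this[of "k - 1"] show "mtrace (a ^\<^sub>m k) = 0" using \<open>k > 0\<close> augmentation_mtrace by simp
qed

lemma unipotent_products_carrier: "A \<in> unipotent_products m G n \<Longrightarrow> A \<in> carrier_mat m m"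
  by (induction n arbitrary: A) (auto intro!: mult_carrier_mat[of _ _ m] simp: carr)

text \<open>
  Kolchin's theorem in the form of a nilpotency statement, with a bound that is uniform in the
  elements of \<open>G\<close>.
\<close>
theorem unipotent_products_vanish:
  assumes "A \<in> unipotent_products m G (Suc m)"
  shows "A = 0\<^sub>m m m"
proof -
  let ?K = "null_filtration m (augmentation m G)"
  note prod = unipotent_products_carrier
  have kill: "A *\<^sub>v v = 0\<^sub>v m" if "A \<in> unipotent_products m G n" "v \<in> ?K n" for A v n
    using that
  proof (induction n arbitrary: A v)
    case 0 thus ?case by simp
  next
    case (Suc n)
    then obtain B g where B: "B \<in> unipotent_products m G n" "g \<in> G" "A = B * (g - 1\<^sub>m m)" by auto
    have "A *\<^sub>v v = B *\<^sub>v ((g - 1\<^sub>m m) *\<^sub>v v)"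
      unfolding B(3) using prod[OF B(1)] carr[OF B(2)] Suc.prems(2)
      by (intro assoc_mult_mat_vec[of _ m m _ m]) auto
    thus ?case using Suc.IH[OF B(1)] Suc.prems(2) diff_in_augmentation[OF B(2)] by auto
  qed
  have full: "?K (Suc m) = carrier_vec m"
    using augmentation_carrier augmentation.zero augmentation_add augmentation_smult augmentation_mult
      augmentation_nilpotent by (intro nil_algebra_null_filtration) auto
  have c: "A \<in> carrier_mat m m" by (rule prod[OF assms])
  show ?thesis
  proof (rule eq_matI)
    \<comment> \<open>A matrix killing all unit vectors is zero.\<close>
    fix i j assume ij: "i < dim_row (0\<^sub>m m m :: 'a mat)" "j < dim_col (0\<^sub>m m m :: 'a mat)"
    have "A *\<^sub>v unit_vec m j = 0\<^sub>v m"
      using kill[OF assms, of "unit_vec m j"] unfolding full by simp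
    hence "(A *\<^sub>v unit_vec m j) $ i = 0" using ij by simp
    thus "A $$ (i, j) = 0\<^sub>m m m $$ (i, j)" using ij c by simp
  qed (use c in auto)
qed

end

section \<open>Polynomial paths in matrix groups\<close>

lemma GL_simps:
  "carrier (GL m) = {A \<in> carrier_mat m m. \<exists>B\<in>carrier_mat m m. B * A = 1\<^sub>m m \<and> A * B = 1\<^sub>m m}"
  "monoid.mult (GL m) = (*)" "monoid.one (GL m) = 1\<^sub>m m"
  by (auto simp: GL_def units_of_def Units_def ring_mat_simps)

lemma group_GL: "group (GL m :: 'k::field mat monoid)"
proof -
  interpret semiring "ring_mat TYPE('k) m ()" by (rule semiring_mat)
  show ?thesis unfolding GL_def by (rule units_group)
qed

locale matrix_group =
  fixes m :: nat and G :: "'k::field mat set"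
  assumes sub: "subgroup G (GL m)"
begin

abbreviation "K \<equiv> (GL m)\<lparr>carrier := G\<rparr>"

sublocale K: group K
  rewrites "carrier K = G" and "monoid.mult K = (*)" and "monoid.one K = 1\<^sub>m m"
proof -
  interpret GL: group "GL m :: 'k mat monoid" by (rule group_GL)
  show "group K" using GL.subgroup_imp_group[OF sub] .
qed (simp_all add: GL_simps)

lemma carr: "g \<in> G \<Longrightarrow> g \<in> carrier_mat m m"
  using subgroup.subset[OF sub] by (auto simp: GL_simps)

lemma inv_mat: "g \<in> G \<Longrightarrow> inv\<^bsub>K\<^esub> g \<in> G" "g \<in> G \<Longrightarrow> g * inv\<^bsub>K\<^esub> g = 1\<^sub>m m" "g \<in> G \<Longrightarrow> inv\<^bsub>K\<^esub> g * g = 1\<^sub>m m"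
  using K.inv_closed K.r_inv K.l_inv by auto

text \<open>
  The inverse path is required to be polynomial too, so that commutators of paths are again
  paths.
\<close>
definition poly_path :: "('k \<Rightarrow> 'k mat) \<Rightarrow> bool" where
  "poly_path \<gamma> \<longleftrightarrow> (\<forall>t. \<gamma> t \<in> G) \<and>
     (\<forall>i<m. \<forall>j<m. (\<lambda>t. \<gamma> t $$ (i, j)) \<in> upoly_funs \<and> (\<lambda>t. (inv\<^bsub>K\<^esub> (\<gamma> t)) $$ (i, j)) \<in> upoly_funs)"

lemma mat_mult_upoly:
  assumes "\<And>t. A t \<in> carrier_mat m m" "\<And>t. B t \<in> carrier_mat m m"
    "\<And>i j. i < m \<Longrightarrow> j < m \<Longrightarrow> (\<lambda>t. A t $$ (i, j)) \<in> poly_funs C"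
    "\<And>i j. i < m \<Longrightarrow> j < m \<Longrightarrow> (\<lambda>t. B t $$ (i, j)) \<in> poly_funs C"
    and ij: "i < m" "j < m"
  shows "(\<lambda>t. (A t * B t) $$ (i, j)) \<in> poly_funs C"
proof -
  have "(\<lambda>t. (A t * B t) $$ (i, j)) = (\<lambda>t. \<Sum>l<m. A t $$ (i, l) * B t $$ (l, j))"
  proof
    fix t show "(A t * B t) $$ (i, j) = (\<Sum>l<m. A t $$ (i, l) * B t $$ (l, j))"
      using assms(1)[of t] assms(2)[of t] ij by (simp add: scalar_prod_def atLeast0LessThan)
  qed
  also have "\<dots> \<in> poly_funs C"
    using ij by (intro poly_funs_sum poly_funs.mult assms(3,4)) auto
  finally show ?thesis .
qed

lemma poly_path_mult:
  assumes "poly_path \<gamma>" "poly_path \<delta>" shows "poly_path (\<lambda>t. \<gamma> t * \<delta> t)"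
proof -
  have mem: "\<gamma> t \<in> G" "\<delta> t \<in> G" for t using assms by (auto simp: poly_path_def)
  have inv: "inv\<^bsub>K\<^esub> (\<gamma> t * \<delta> t) = inv\<^bsub>K\<^esub> (\<delta> t) * inv\<^bsub>K\<^esub> (\<gamma> t)" for t
    using K.inv_mult_group mem by auto
  show ?thesis unfolding poly_path_def inv
  proof (intro conjI allI impI)
    show "\<gamma> t * \<delta> t \<in> G" for t using K.m_closed mem by auto
    fix i j assume "i < m" "j < m"
    thus "(\<lambda>t. (\<gamma> t * \<delta> t) $$ (i, j)) \<in> upoly_funs" 
      "(\<lambda>t. (inv\<^bsub>K\<^esub> (\<delta> t) * inv\<^bsub>K\<^esub> (\<gamma> t)) $$ (i, j)) \<in> upoly_funs"
      using assms mem inv_mat(1) by (auto intro!: mat_mult_upoly simp: poly_path_def carr)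
  qed
qed

lemma poly_path_inv:
  assumes "poly_path \<gamma>" shows "poly_path (\<lambda>t. inv\<^bsub>K\<^esub> (\<gamma> t))"
proof -
  have mem: "\<gamma> t \<in> G" for t using assms by (auto simp: poly_path_def)
  hence "inv\<^bsub>K\<^esub> (inv\<^bsub>K\<^esub> (\<gamma> t)) = \<gamma> t" for t by simp
  thus ?thesis using assms inv_mat(1) by (auto simp: poly_path_def)
qed

definition path_connected_subset :: "'k mat set \<Rightarrow> bool" where
  "path_connected_subset H \<longleftrightarrow> (\<forall>h\<in>H. \<exists>\<gamma>. poly_path \<gamma> \<and> range \<gamma> \<subseteq> H \<and> \<gamma> 0 = 1\<^sub>m m \<and> \<gamma> 1 = h)"

text \<open>
  If \<open>\<alpha>\<close> and \<open>\<beta>\<close> join \<open>1\<close> to \<open>a\<close> and \<open>b\<close>, the path of commutators of \<open>\<alpha> t\<close> and \<open>\<beta> t\<close> joins \<open>1\<close> to the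
  commutator of \<open>a\<close> and \<open>b\<close> inside the set of commutators; products and inverses of such paths reach the
  subgroup generated by it.
\<close>
lemma path_connected_derived:
  assumes H: "H \<subseteq> G" "path_connected_subset H"
  shows "path_connected_subset (derived K H)"
proof -
  define D where "D = (\<Union>a\<in>H. \<Union>b\<in>H. {a * b * inv\<^bsub>K\<^esub> a * inv\<^bsub>K\<^esub> b})"
  have D: "derived K H = generate K D" by (simp add: derived_def D_def GL_simps(2))
  have one: "1\<^sub>m m \<in> G" using K.one_closed by simp
  have comm: "\<exists>\<gamma>. poly_path \<gamma> \<and> range \<gamma> \<subseteq> D \<and> \<gamma> 0 = 1\<^sub>m m \<and> \<gamma> 1 = c" if c: "c \<in> D" for c
  proof -
    obtain a b where ab: "a \<in> H" "b \<in> H" "c = a * b * inv\<^bsub>K\<^esub> a * inv\<^bsub>K\<^esub> b"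
      using c by (auto simp: D_def)
    obtain \<alpha> where \<alpha>: "poly_path \<alpha>" "range \<alpha> \<subseteq> H" "\<alpha> 0 = 1\<^sub>m m" "\<alpha> 1 = a"
      using H(2) ab(1) by (auto simp: path_connected_subset_def)
    obtain \<beta> where \<beta>: "poly_path \<beta>" "range \<beta> \<subseteq> H" "\<beta> 0 = 1\<^sub>m m" "\<beta> 1 = b"
      using H(2) ab(2) by (auto simp: path_connected_subset_def)
    define \<gamma> where "\<gamma> t = \<alpha> t * \<beta> t * inv\<^bsub>K\<^esub> (\<alpha> t) * inv\<^bsub>K\<^esub> (\<beta> t)" for t
    have "poly_path \<gamma>" unfolding \<gamma>_def[abs_def] using \<alpha>(1) \<beta>(1) by (intro poly_path_mult poly_path_inv)
    moreover have "range \<gamma> \<subseteq> D"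
    proof (rule image_subsetI)
      fix t
      have "\<alpha> t \<in> H" "\<beta> t \<in> H" using \<alpha>(2) \<beta>(2) by auto
      thus "\<gamma> t \<in> D" unfolding \<gamma>_def D_def by blast
    qed
    moreover have "inv\<^bsub>K\<^esub> (1\<^sub>m m) = 1\<^sub>m m" using K.inv_one by simp
    hence "\<gamma> 0 = 1\<^sub>m m" by (simp add: \<gamma>_def \<alpha>(3) \<beta>(3))
    moreover have "\<gamma> 1 = c" by (simp add: \<gamma>_def \<alpha>(4) \<beta>(4) ab(3))
    ultimately show ?thesis by blast
  qed
  have "\<exists>\<gamma>. poly_path \<gamma> \<and> range \<gamma> \<subseteq> generate K D \<and> \<gamma> 0 = 1\<^sub>m m \<and> \<gamma> 1 = h"
    if "h \<in> generate K D" for h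
    using that
  proof (induction rule: generate.induct)
    case one
    have "poly_path (\<lambda>_. 1\<^sub>m m)"
      using \<open>1\<^sub>m m \<in> G\<close> K.inv_one by (auto simp: poly_path_def intro: poly_funs.const)
    thus ?case using generate.one[of K D] by (intro exI[of _ "\<lambda>_. 1\<^sub>m m"]) (auto simp: GL_simps(3))
  next
    case (incl c)
    thus ?case using comm[OF incl] generate.incl[of _ D K] by blast
  next
    case (inv c)
    obtain \<gamma> where \<gamma>: "poly_path \<gamma>" "range \<gamma> \<subseteq> D" "\<gamma> 0 = 1\<^sub>m m" "\<gamma> 1 = c"
      using comm[OF inv] by blast
    have "inv\<^bsub>K\<^esub> (1\<^sub>m m) = 1\<^sub>m m" using K.inv_one by simp
    thus ?case using \<gamma> poly_path_inv[OF \<gamma>(1)] generate.inv[of _ D K]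
      by (intro exI[of _ "\<lambda>t. inv\<^bsub>K\<^esub> (\<gamma> t)"]) auto
  next
    case (eng a b)
    obtain \<gamma> where \<gamma>: "poly_path \<gamma>" "range \<gamma> \<subseteq> generate K D" "\<gamma> 0 = 1\<^sub>m m" "\<gamma> 1 = a"
      using eng.IH(1) by blast
    obtain \<delta> where \<delta>: "poly_path \<delta>" "range \<delta> \<subseteq> generate K D" "\<delta> 0 = 1\<^sub>m m" "\<delta> 1 = b"
      using eng.IH(2) by blast
    have mult: "x * y \<in> generate K D" if "x \<in> generate K D" "y \<in> generate K D" for x y
      using generate.eng[OF that] by (simp add: GL_simps(2))
    have "range (\<lambda>t. \<gamma> t * \<delta> t) \<subseteq> generate K D" using mult \<gamma>(2) \<delta>(2) by blast
    thus ?case using \<gamma> \<delta> poly_path_mult[OF \<gamma>(1) \<delta>(1)]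
      by (intro exI[of _ "\<lambda>t. \<gamma> t * \<delta> t"]) (auto simp: GL_simps(2))
  qed
  thus ?thesis by (simp add: path_connected_subset_def D)
qed

lemma path_connected_exp_derived:
  assumes "path_connected_subset G" shows "path_connected_subset ((derived K ^^ k) G)"
  by (induction k) (use assms path_connected_derived K.exp_of_derived_in_carrier[OF order_refl] in auto)

end

text \<open>
  The binomial series for \<open>g\<^sup>t = (1 + (g - 1))\<^sup>t\<close>, which is finite for unipotent \<open>g\<close>.  Truncation at
  an explicit \<open>K\<close> keeps it defined for every \<open>g\<close>.
\<close>
definition unipotent_power :: "nat \<Rightarrow> nat \<Rightarrow> 'k::field_char_0 mat \<Rightarrow> 'k \<Rightarrow> 'k mat" where
  "unipotent_power m K g t = mat m m (\<lambda>(i,j). \<Sum>k<K. (t gchoose k) * ((g - 1\<^sub>m m) ^\<^sub>m k) $$ (i, j))"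

lemma unipotent_power_carrier [simp]: "unipotent_power m K g t \<in> carrier_mat m m"
  by (simp add: unipotent_power_def)

text \<open>Pascal's rule for binomial coefficients with an exponent in the field.\<close>
lemma unipotent_power_Suc:
  assumes g: "g \<in> carrier_mat m m" and nil: "(g - 1\<^sub>m m) ^\<^sub>m K = 0\<^sub>m m m"
  shows "unipotent_power m (Suc K) g t * g = unipotent_power m (Suc K) g (t + 1)"
proof (rule eq_matI)
  define N where "N = g - 1\<^sub>m m"
  have N: "N \<in> carrier_mat m m" using g by (auto simp: N_def)
  fix i j assume "i < dim_row (unipotent_power m (Suc K) g (t + 1))" "j < dim_col (unipotent_power m (Suc K) g (t + 1))"
  hence ij: "i < m" "j < m" by (auto simp: unipotent_power_def)
  have gN: "g $$ (l, j) = (if l = j then 1 else 0) + N $$ (l, j)" if "l < m" for l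
    using g that ij by (simp add: N_def)
  have Npow: "(N ^\<^sub>m Suc k) $$ (i,j) = (\<Sum>l<m. (N ^\<^sub>m k) $$ (i,l) * N $$ (l,j))" for k
    using N pow_carrier_mat[OF N, of k] ij by (simp add: scalar_prod_def atLeast0LessThan)
  let ?u = "\<lambda>l. (\<Sum>k<Suc K. (t gchoose k) * (N ^\<^sub>m k) $$ (i, l))"
  have "(unipotent_power m (Suc K) g t * g) $$ (i, j) = (\<Sum>l<m. ?u l * g $$ (l, j))"
    using g ij unipotent_power_carrier[of m "Suc K" g t]
    by (simp add: scalar_prod_def atLeast0LessThan unipotent_power_def N_def)
  also have "\<dots> = (\<Sum>l<m. (if l = j then ?u l else 0) + ?u l * N $$ (l, j))"
    by (intro sum.cong refl) (auto simp: gN algebra_simps)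
  also have "\<dots> = ?u j + (\<Sum>l<m. ?u l * N $$ (l, j))"
    using ij by (simp add: sum.distrib)
  also have "(\<Sum>l<m. ?u l * N $$ (l, j)) = (\<Sum>k<Suc K. (t gchoose k) * (N ^\<^sub>m Suc k) $$ (i, j))"
    unfolding Npow sum_distrib_right sum_distrib_left by (subst sum.swap) (simp add: mult.assoc)
  also have "\<dots> = (\<Sum>k<K. (t gchoose k) * (N ^\<^sub>m Suc k) $$ (i, j))"
  proof -
    have "N ^\<^sub>m Suc K = 0\<^sub>m m m" using nil N by (simp add: N_def)
    thus ?thesis using ij by simp
  qed
  also have "?u j = (N ^\<^sub>m 0) $$ (i, j) + (\<Sum>k<K. (t gchoose Suc k) * (N ^\<^sub>m Suc k) $$ (i, j))"
    by (subst sum.lessThan_Suc_shift) simp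
  finally have "(unipotent_power m (Suc K) g t * g) $$ (i, j) = (N ^\<^sub>m 0) $$ (i, j) + 
      (\<Sum>k<K. ((t + 1) gchoose Suc k) * (N ^\<^sub>m Suc k) $$ (i, j))"
    by (simp only: gbinomial_Suc_Suc distrib_right sum.distrib) (simp only: add_ac)
  also have "\<dots> = (\<Sum>k<Suc K. ((t + 1) gchoose k) * (N ^\<^sub>m k) $$ (i, j))"
    by (subst sum.lessThan_Suc_shift) simp
  finally show "(unipotent_power m (Suc K) g t * g) $$ (i, j) = unipotent_power m (Suc K) g (t + 1) $$ (i, j)"
    using ij by (simp add: unipotent_power_def N_def)
qed (use g in \<open>auto simp: unipotent_power_def\<close>)

lemma unipotent_power_0: 
  assumes "g \<in> carrier_mat m m" shows "unipotent_power m (Suc K) g 0 = 1\<^sub>m m"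
proof (rule eq_matI)
  fix i j assume "i < dim_row (1\<^sub>m m)" "j < dim_col (1\<^sub>m m)"
  thus "unipotent_power m (Suc K) g 0 $$ (i, j) = 1\<^sub>m m $$ (i, j)"
    using assms unfolding unipotent_power_def by (subst sum.lessThan_Suc_shift) (simp add: gbinomial_0_left)
qed (simp_all add: unipotent_power_def)

lemma unipotent_power_upoly:
  assumes "i < m" "j < m" shows "(\<lambda>t. unipotent_power m K g t $$ (i, j)) \<in> upoly_funs"
proof -
  have id: "(\<lambda>t. t) \<in> upoly_funs" by (rule poly_funs.gen) simp
  have gb: "(\<lambda>t. t gchoose k) \<in> upoly_funs" for k :: nat
  proof -
    have "(\<lambda>t. (\<Prod>i=0..<k. t - of_nat i) * inverse (fact k)) \<in> upoly_funs"
      by (intro poly_funs.mult poly_funs_prod poly_funs_diff poly_funs.const id)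
    thus ?thesis by (simp add: gbinomial_prod_rev divide_inverse)
  qed
  show ?thesis using assms unfolding unipotent_power_def
    by simp (intro poly_funs_sum poly_funs.mult poly_funs.const gb)
qed

text \<open>
  For natural \<open>t\<close> this is an induction with the previous rule; both sides have polynomial entries in
  \<open>t\<close>, so it extends to the whole field.
\<close>
lemma unipotent_power_add:
  assumes g: "g \<in> carrier_mat m m" and nil: "(g - 1\<^sub>m m) ^\<^sub>m K = 0\<^sub>m m m"
  shows "unipotent_power m (Suc K) g s * unipotent_power m (Suc K) g t = unipotent_power m (Suc K) g (s + t)"
proof (rule eq_matI)
  let ?u = "unipotent_power m (Suc K) g"
  note c = unipotent_power_carrier[of m "Suc K" g]
  have nat: "?u s * ?u (of_nat n) = ?u (s + of_nat n)" for s n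
  proof (induction n)
    case 0 thus ?case using unipotent_power_0[OF g, of K] right_mult_one_mat[OF c[of s]] by simp
  next
    case (Suc n)
    have "?u s * ?u (of_nat (Suc n)) = ?u s * (?u (of_nat n) * g)"
      using unipotent_power_Suc[OF assms, of "of_nat n"] by (simp add: add.commute)
    also have "\<dots> = ?u (s + of_nat n) * g" 
      using Suc assoc_mult_mat[OF c[of s] c[of "of_nat n"] g] by simp
    also have "\<dots> = ?u (s + of_nat (Suc n))"
      using unipotent_power_Suc[OF assms, of "s + of_nat n"] by (simp add: add_ac)
    finally show ?case .
  qed
  fix i j assume "i < dim_row (?u (s + t))" "j < dim_col (?u (s + t))"
  hence ij: "i < m" "j < m" by (auto simp: unipotent_power_def)
  have "(\<lambda>t. (?u s * ?u t) $$ (i, j)) = (\<lambda>t. \<Sum>l<m. ?u s $$ (i, l) * ?u t $$ (l, j))"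
    using ij c[of s] c by (auto simp: scalar_prod_def atLeast0LessThan unipotent_power_def)
  also have "\<dots> \<in> upoly_funs"
    using ij by (intro poly_funs_sum poly_funs.mult poly_funs.const unipotent_power_upoly) auto
  finally have 1: "(\<lambda>t. (?u s * ?u t) $$ (i, j)) \<in> upoly_funs" .
  have 2: "(\<lambda>t. ?u (s + t) $$ (i, j)) \<in> upoly_funs"
    using poly_funs_subst_UNIV[OF unipotent_power_upoly[OF ij, of "Suc K" g], of "\<lambda>t. s + t" "{\<lambda>t. t}"]
      poly_funs.add[OF poly_funs.const[of s] poly_funs.gen[of "\<lambda>t. t" "{\<lambda>t. t}"]] by simp
  have "(?u s * ?u t) $$ (i, j) - ?u (s + t) $$ (i, j) = 0"
    by (rule upoly_funs_zero[OF poly_funs_diff[OF 1 2]]) (simp add: nat)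
  thus "(?u s * ?u t) $$ (i, j) = ?u (s + t) $$ (i, j)" by simp
qed (simp_all add: unipotent_power_def)

text \<open>
  The path from \<open>1\<close> to \<open>g\<close> is \<open>t \<mapsto> g\<^sup>t\<close>: the equations of \<open>G\<close> are polynomials in \<open>t\<close> along this path
  and vanish at all natural numbers.
\<close>
lemma unipotent_group_path_connected:
  fixes G :: "'k::field_char_0 mat set"
  assumes "unipotent_group m G"
  shows "matrix_group.path_connected_subset m G G"
proof -
  have lag: "subgroup G (GL m)" "\<exists>S \<subseteq> poly_funs (mat_coords m). G = {g \<in> carrier (GL m). \<forall>f\<in>S. f g = 0}"
    and unip: "\<And>g. g \<in> G \<Longrightarrow> unipotent_mat m g"
    using assms by (auto simp: unipotent_group_def linear_algebraic_group_def)
  interpret matrix_group m G by (rule matrix_group.intro[OF lag(1)])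
  obtain S where S: "S \<subseteq> poly_funs (mat_coords m)" "G = {g \<in> carrier (GL m). \<forall>f\<in>S. f g = 0}"
    using lag(2) by blast
  have GS: "g \<in> G \<longleftrightarrow> g \<in> carrier (GL m) \<and> (\<forall>f\<in>S. f g = 0)" for g
    by (subst S(2)) simp
  show ?thesis unfolding path_connected_subset_def
  proof
    fix g assume g: "g \<in> G"
    obtain K0 where nil: "(g - 1\<^sub>m m) ^\<^sub>m K0 = 0\<^sub>m m m" using unip[OF g] by (auto simp: unipotent_mat_def)
    let ?u = "unipotent_power m (Suc K0) g"
    note gc = carr[OF g]
    have add: "?u s * ?u t = ?u (s + t)" for s t by (rule unipotent_power_add[OF gc nil])
    have zero: "?u 0 = 1\<^sub>m m" by (rule unipotent_power_0[OF gc])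
    have one: "?u 1 = g" using unipotent_power_Suc[OF gc nil, of 0] zero gc by simp
    have natG: "?u (of_nat n) \<in> G" for n
    proof (induction n)
      case 0 thus ?case using zero K.one_closed by simp
    next
      case (Suc n)
      have "?u (of_nat n) * g \<in> G" using K.m_closed Suc g by auto
      thus ?case using unipotent_power_Suc[OF gc nil, of "of_nat n"] by (simp add: add.commute)
    qed
    have mem: "?u t \<in> G" for t
    proof -
      have "?u t \<in> carrier (GL m)"
        unfolding GL_simps using add[of t "-t"] add[of "-t" t] zero by (auto intro!: bexI[of _ "?u (-t)"])
      moreover have "f (?u t) = 0" if f: "f \<in> S" for f
      proof (rule upoly_funs_zero[where f = "\<lambda>t. f (?u t)"])
        show "(\<lambda>t. f (?u t)) \<in> upoly_funs"
        proof (rule poly_funs_subst_UNIV[where p = f and h = ?u and C = "mat_coords m"])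
          show "f \<in> poly_funs (mat_coords m)" using f S(1) by blast
          fix h :: "'k mat \<Rightarrow> 'k" assume "h \<in> mat_coords m"
          then obtain i j where "h = (\<lambda>g. g $$ (i, j))" "i < m" "j < m" by (auto simp: mat_coords_def)
          thus "(\<lambda>x. h (?u x)) \<in> upoly_funs" using unipotent_power_upoly by simp
        qed
        show "f (?u (of_nat n)) = 0" for n using natG[of n] f unfolding GS by blast
      qed
      ultimately show ?thesis unfolding GS by blast
    qed
    have inv: "inv\<^bsub>K\<^esub> (?u t) = ?u (- t)" for t
      using K.inv_equality[of "?u (-t)" "?u t"] mem add[of "-t" t] zero by simp
    have neg: "(\<lambda>t. ?u (- t) $$ (i, j)) \<in> upoly_funs" if "i < m" "j < m" for i j
      using poly_funs_subst_UNIV[OF unipotent_power_upoly[OF that, of "Suc K0" g], of "\<lambda>t. - t" "{\<lambda>t. t}"]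
        poly_funs_diff[OF poly_funs.const[of 0] poly_funs.gen[of "\<lambda>t. t" "{\<lambda>t. t}"]] by simp
    have "poly_path ?u" unfolding poly_path_def inv using mem unipotent_power_upoly neg by auto
    moreover have "range ?u \<subseteq> G" by (rule image_subsetI) (rule mem)
    ultimately show "\<exists>\<gamma>. poly_path \<gamma> \<and> range \<gamma> \<subseteq> G \<and> \<gamma> 0 = 1\<^sub>m m \<and> \<gamma> 1 = g"
      by (intro exI[of _ ?u] conjI zero one)
  qed
qed

section \<open>Iterated differences of functions\<close>

text \<open>
  Any \<open>N\<close> iterated differences of \<open>f\<close> along elements of \<open>H\<close>, acting through \<open>T\<close>, vanish on \<open>P\<close>.
  For a group acting linearly this says that \<open>f\<close> lies in a unipotent representation.
\<close>
primrec difference_nilpotent ::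
    "('h \<Rightarrow> 'p \<Rightarrow> 'p) \<Rightarrow> 'h set \<Rightarrow> 'p set \<Rightarrow> nat \<Rightarrow> ('p \<Rightarrow> 'k::comm_ring_1) \<Rightarrow> bool" where
  "difference_nilpotent T H P 0 f \<longleftrightarrow> (\<forall>p\<in>P. f p = 0)"
| "difference_nilpotent T H P (Suc N) f \<longleftrightarrow> (\<forall>h\<in>H. difference_nilpotent T H P N (\<lambda>p. f (T h p) - f p))"

locale stable_set =
  fixes T :: "'h \<Rightarrow> 'p \<Rightarrow> 'p" and H :: "'h set" and P :: "'p set"
  assumes stable: "h \<in> H \<Longrightarrow> p \<in> P \<Longrightarrow> T h p \<in> P"
begin

abbreviation "dn \<equiv> difference_nilpotent T H P"

lemma dn_cong: "dn N f \<Longrightarrow> (\<And>p. p \<in> P \<Longrightarrow> f p = g p) \<Longrightarrow> dn N g"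
proof (induction N arbitrary: f g)
  case (Suc N)
  show ?case unfolding difference_nilpotent.simps
  proof
    fix h assume h: "h \<in> H"
    have "dn N (\<lambda>p. f (T h p) - f p)" using Suc.prems(1) h by simp
    thus "dn N (\<lambda>p. g (T h p) - g p)"
    proof (rule Suc.IH)
      fix p assume p: "p \<in> P"
      show "f (T h p) - f p = g (T h p) - g p"
        using Suc.prems(2)[OF p] Suc.prems(2)[OF stable[OF h p]] by simp
    qed
  qed
qed simp

lemma dn_zero: "(\<And>p. p \<in> P \<Longrightarrow> f p = 0) \<Longrightarrow> dn N f"
  by (induction N arbitrary: f) (auto simp: stable)

lemma dn_Suc: "dn N f \<Longrightarrow> dn (Suc N) f"
proof (induction N arbitrary: f)
  case 0
  thus ?case using stable by auto
next
  case (Suc N)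
  show ?case unfolding difference_nilpotent.simps(2)[of T H P "Suc N"]
  proof
    fix h assume "h \<in> H"
    hence "dn N (\<lambda>p. f (T h p) - f p)" using Suc.prems by simp
    thus "dn (Suc N) (\<lambda>p. f (T h p) - f p)" by (rule Suc.IH)
  qed
qed

lemma dn_mono:
  assumes "N \<le> M" "dn N f" shows "dn M f"
  using assms(1)
proof (induction rule: dec_induct)
  case base show ?case by (rule assms(2))
next
  case (step k) thus ?case by (intro dn_Suc)
qed

lemma dn_const: "dn (Suc 0) (\<lambda>_. c)"
  by simp

lemma dn_add: "dn N f \<Longrightarrow> dn N g \<Longrightarrow> dn N (\<lambda>p. f p + g p)"
proof (induction N arbitrary: f g)
  case (Suc N)
  show ?case unfolding difference_nilpotent.simps
  proof
    fix h assume h: "h \<in> H"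
    have "dn N (\<lambda>p. (f (T h p) - f p) + (g (T h p) - g p))"
      using Suc.prems h by (intro Suc.IH) simp_all
    thus "dn N (\<lambda>p. f (T h p) + g (T h p) - (f p + g p))"
      by (rule dn_cong) simp
  qed
qed simp

text \<open>
  With \<open>\<Delta> f = f \<circ> T h - f\<close> the product rule is \<open>\<Delta> (f g) = \<Delta> f g + f \<Delta> g + \<Delta> f \<Delta> g\<close>, and each term
  has a smaller sum of orders.  Thus the functions of finite order form an algebra.
\<close>
lemma dn_mult: "dn N f \<Longrightarrow> dn M g \<Longrightarrow> dn (N + M) (\<lambda>p. f p * g p)"
proof (induction "N + M" arbitrary: N M f g rule: less_induct)
  case less
  show ?case
  proof (cases "N = 0 \<or> M = 0")
    case True
    thus ?thesis using less.prems by (intro dn_zero) auto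
  next
    case False
    then obtain N' M' where NM: "N = Suc N'" "M = Suc M'" by (cases N; cases M) auto
    have "dn (N' + M) (\<lambda>p. f (T h p) * g (T h p) - f p * g p)" if h: "h \<in> H" for h
    proof -
      let ?f = "\<lambda>p. f (T h p) - f p" and ?g = "\<lambda>p. g (T h p) - g p"
      have fg: "dn N' ?f" "dn M' ?g" using less.prems h NM by auto
      have 1: "dn (N' + M) (\<lambda>p. ?f p * g p)" 
        by (rule less.hyps[OF _ fg(1) less.prems(2)]) (simp add: NM)
      have "N' + M = N + M'" by (simp add: NM)
      moreover have "dn (N + M') (\<lambda>p. f p * ?g p)" 
        by (rule less.hyps[OF _ less.prems(1) fg(2)]) (simp add: NM)
      ultimately have 2: "dn (N' + M) (\<lambda>p. f p * ?g p)" by (simp only:)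
      have "dn (N' + M') (\<lambda>p. ?f p * ?g p)" 
        by (rule less.hyps[OF _ fg]) (simp add: NM)
      hence 3: "dn (N' + M) (\<lambda>p. ?f p * ?g p)" by (rule dn_mono[rotated]) (simp add: NM)
      show ?thesis
        by (rule dn_cong[OF dn_add[OF dn_add[OF 1 2] 3]]) (simp add: algebra_simps)
    qed
    thus ?thesis unfolding NM add_Suc difference_nilpotent.simps(2) by blast
  qed
qed

end

section \<open>Orbits of a unipotent group\<close>

locale unipotent_action =
  fixes m :: nat and G :: "'k::{alg_closed_field, field_char_0} mat set" and n :: nat
    and X :: "'k vec set" and \<rho> :: "'k mat \<Rightarrow> 'k vec \<Rightarrow> 'k vec"
  assumes unip: "unipotent_group m G" and act: "regular_action m G n X \<rho>"
    and X: "X \<subseteq> carrier_vec n"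
begin

sublocale matrix_group m G
  by (rule matrix_group.intro) (use unip in \<open>auto simp: unipotent_group_def linear_algebraic_group_def\<close>)

sublocale ug: unipotent_semigroup m G
proof
  show "g * h \<in> G" if "g \<in> G" "h \<in> G" for g h using K.m_closed that by simp
  show "unipotent_mat m g" if "g \<in> G" for g using unip that by (simp add: unipotent_group_def)
qed (rule carr)

sublocale left: stable_set "\<lambda>h g. h * g" G G
  by unfold_locales (rule ug.mult)

lemma act_mult: "g \<in> G \<Longrightarrow> h \<in> G \<Longrightarrow> x \<in> X \<Longrightarrow> \<rho> (g * h) x = \<rho> g (\<rho> h x)"
  and act_one: "x \<in> X \<Longrightarrow> \<rho> (1\<^sub>m m) x = x"
  and act_closed: "g \<in> G \<Longrightarrow> x \<in> X \<Longrightarrow> \<rho> g x \<in> X"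
proof -
  have ga: "group_action K X \<rho>" using act by (simp add: regular_action_def)
  show "g \<in> G \<Longrightarrow> h \<in> G \<Longrightarrow> x \<in> X \<Longrightarrow> \<rho> (g * h) x = \<rho> g (\<rho> h x)"
    using group_action.composition_rule[OF ga, of x g h] by (simp add: GL_simps(2))
  show "x \<in> X \<Longrightarrow> \<rho> (1\<^sub>m m) x = x"
    using fun_cong[OF group_action.id_eq_one[OF ga], of x] by (simp add: GL_simps(3))
  show "g \<in> G \<Longrightarrow> x \<in> X \<Longrightarrow> \<rho> g x \<in> X"
    using group_action.element_image[OF ga, of g x "\<rho> g x"] by simp
qed

sublocale pts: stable_set \<rho> G X
  by unfold_locales (rule act_closed)

lemma act_poly:
  assumes "j < n"
  obtains p where "p \<in> poly_funs (action_coords m n)" "\<And>g x. g \<in> G \<Longrightarrow> x \<in> X \<Longrightarrow> \<rho> g x $ j = p (g, x)"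
  using act assms unfolding regular_action_def by blast

text \<open>
  The difference along \<open>h\<close> of \<open>g \<mapsto> A g\<close> under left translation is \<open>g \<mapsto> A (h - 1) g\<close>; iterating
  produces the products that vanish by Kolchin's theorem.
\<close>
lemma entry_difference_nilpotent:
  assumes "i < m" "j < m" "A \<in> unipotent_products m G k" "k + N = Suc m"
  shows "left.dn N (\<lambda>g. (A * g) $$ (i, j))"
  using assms(3,4)
proof (induction N arbitrary: A k)
  case 0
  hence "A = 0\<^sub>m m m" using ug.unipotent_products_vanish by simp
  moreover have "0\<^sub>m m m * g = 0\<^sub>m m m" if "g \<in> G" for g
    by (rule left_mult_zero_mat[OF carr[OF that]])
  ultimately show ?case using assms(1,2) by simp
next
  case (Suc N)
  have A: "A \<in> carrier_mat m m" by (rule ug.unipotent_products_carrier[OF Suc.prems(1)])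
  show ?case unfolding difference_nilpotent.simps
  proof
    fix h assume h: "h \<in> G"
    have "left.dn N (\<lambda>g. (A * (h - 1\<^sub>m m) * g) $$ (i, j))"
      using Suc.prems h by (intro Suc.IH[of _ "Suc k"]) auto
    thus "left.dn N (\<lambda>g. (A * (h * g)) $$ (i, j) - (A * g) $$ (i, j))"
    proof (rule left.dn_cong)
      fix g assume g: "g \<in> G"
      have c: "g \<in> carrier_mat m m" "h \<in> carrier_mat m m" using g h carr by auto
      have "A * (h - 1\<^sub>m m) = A * h - A" using A c mult_minus_distrib_mat[OF A c(2), of "1\<^sub>m m"] by simp
      hence "A * (h - 1\<^sub>m m) * g = A * h * g - A * g"
        using minus_mult_distrib_mat[of "A * h" m m A g m] A c by simp
      also have "A * h * g = A * (h * g)" using A c by (intro assoc_mult_mat[of _ m m _ m _ m])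
      finally have eq: "A * (h - 1\<^sub>m m) * g = A * (h * g) - A * g" .
      have "A * g \<in> carrier_mat m m" using A c by simp
      thus "(A * (h - 1\<^sub>m m) * g) $$ (i, j) = (A * (h * g)) $$ (i, j) - (A * g) $$ (i, j)"
        unfolding eq using assms(1,2) by (intro index_minus_mat(1)) auto
    qed
  qed
qed

lemma entry_nilpotent:
  assumes "i < m" "j < m" shows "left.dn (Suc m) (\<lambda>g. g $$ (i, j))"
  by (rule left.dn_cong[OF entry_difference_nilpotent[OF assms, of "1\<^sub>m m" 0 "Suc m"]])
     (use carr in auto)

text \<open>
  The determinant is a polynomial in the entries, so it is annihilated by sufficiently many
  differences.  Being multiplicative, it is multiplied by \<open>det h - 1\<close> under the difference along
  \<open>h\<close>, so some power of \<open>det h - 1\<close> is zero.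
\<close>
lemma det_one:
  assumes h: "h \<in> G" shows "det h = 1"
proof -
  have "\<exists>N. left.dn N p" if "p \<in> poly_funs (mat_coords m)" for p
    using that
  proof (induction rule: poly_funs.induct)
    case (const c) show ?case using left.dn_const by blast
  next
    case (gen f) thus ?case using entry_nilpotent unfolding mat_coords_def by blast
  next
    case (add f g)
    then obtain N M where "left.dn N f" "left.dn M g" by blast
    hence "left.dn (max N M) f" "left.dn (max N M) g"
      using left.dn_mono max.cobounded1 max.cobounded2 by blast+
    thus ?case using left.dn_add by blast
  next
    case (mult f g) thus ?case using left.dn_mult by blast
  qed
  moreover obtain q :: "'k mat \<Rightarrow> 'k" where q: "q \<in> poly_funs (mat_coords m)" "\<And>g. g \<in> carrier_mat m m \<Longrightarrow> det g = q g"
    by (rule poly_funs_det[of m "\<lambda>g. g" "mat_coords m"]) (auto simp: mat_coords_def intro: poly_funs.gen)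
  ultimately obtain N where "left.dn N q" by blast
  hence dn: "left.dn N (\<lambda>g. 1 * det g)" using q(2) carr by (auto intro: left.dn_cong)
  have "c * (det h - 1) ^ N * det g = 0" if dn: "left.dn N (\<lambda>g. c * det g)" and g: "g \<in> G" for c g N
    using dn
  proof (induction N arbitrary: c)
    case 0
    hence "c * det g = 0" using g unfolding difference_nilpotent.simps by blast
    thus ?case by simp
  next
    case (Suc N)
    have "left.dn N (\<lambda>g. c * det (h * g) - c * det g)" using Suc.prems h by simp
    hence "left.dn N (\<lambda>g. (c * (det h - 1)) * det g)"
      by (rule left.dn_cong) (use h carr in \<open>simp add: det_mult[of _ m] algebra_simps\<close>)
    thus ?case using Suc.IH[of "c * (det h - 1)"] by (simp add: mult_ac)
  qed
  from this[OF dn, of "1\<^sub>m m"] show ?thesis using K.one_closed by simp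
qed

text \<open>The order \<open>N\<close> does not depend on the point \<open>x\<close>, which only contributes to the coefficients.\<close>
lemma action_poly_nilpotent:
  assumes "p \<in> poly_funs (action_coords m n)"
  shows "\<exists>N. \<forall>x. left.dn N (\<lambda>g. p (g, x))"
  using assms
proof (induction rule: poly_funs.induct)
  case (const c) show ?case using left.dn_const by blast
next
  case (gen f)
  then consider i j where "f = (\<lambda>(g, x). g $$ (i, j))" "i < m" "j < m" | "f = (\<lambda>(g, x). inverse (det g))"
    | i where "f = (\<lambda>(g, x). x $ i)" "i < n" by (auto simp: action_coords_def)
  thus ?case
  proof cases
    case 1
    have "left.dn (Suc m) (\<lambda>g. f (g, x))" for x
      unfolding 1(1) prod.case by (rule entry_nilpotent[OF 1(2,3)])
    thus ?thesis by blast
  next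
    case 2
    have "left.dn (Suc 0) (\<lambda>g. f (g, x))" for x
      unfolding 2 prod.case by (rule left.dn_cong[OF left.dn_const[of 1]]) (simp add: det_one)
    thus ?thesis by blast
  next
    case 3
    have "left.dn (Suc 0) (\<lambda>g. f (g, x))" for x using 3 by simp
    thus ?thesis by blast
  qed
next
  case (add f g)
  then obtain N M where "\<And>x. left.dn N (\<lambda>a. f (a, x))" "\<And>x. left.dn M (\<lambda>a. g (a, x))" by blast
  hence "left.dn (max N M) (\<lambda>a. f (a, x))" "left.dn (max N M) (\<lambda>a. g (a, x))" for x
    using left.dn_mono[of N "max N M"] left.dn_mono[of M "max N M"] by auto
  thus ?case using left.dn_add by blast
next
  case (mult f g) thus ?case using left.dn_mult by blast
qed

text \<open>
  Differences on \<open>X\<close> and left differences on \<open>G\<close> correspond under each orbit map \<open>g \<mapsto> \<rho> g x\<close>; a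
  function on \<open>X\<close> is recovered from its pullbacks at \<open>g = 1\<close>.
\<close>
lemma orbit_difference_nilpotent:
  assumes "\<And>x. x \<in> X \<Longrightarrow> left.dn N (\<lambda>g. f (\<rho> g x))"
  shows "pts.dn N f"
  using assms
proof (induction N arbitrary: f)
  case 0
  show ?case unfolding difference_nilpotent.simps
  proof
    fix x assume x: "x \<in> X"
    have "1\<^sub>m m \<in> G" using K.one_closed by simp
    hence "f (\<rho> (1\<^sub>m m) x) = 0" using 0[OF x] unfolding difference_nilpotent.simps by blast
    thus "f x = 0" using act_one[OF x] by simp
  qed
next
  case (Suc N)
  show ?case unfolding difference_nilpotent.simps
  proof
    fix h assume h: "h \<in> G"
    show "pts.dn N (\<lambda>p. f (\<rho> h p) - f p)"
    proof (rule Suc.IH)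
      fix x assume x: "x \<in> X"
      have "left.dn N (\<lambda>g. f (\<rho> (h * g) x) - f (\<rho> g x))" using Suc.prems[OF x] h by simp
      thus "left.dn N (\<lambda>g. f (\<rho> h (\<rho> g x)) - f (\<rho> g x))"
        by (rule left.dn_cong) (simp add: act_mult h x)
    qed
  qed
qed

lemma coord_difference_nilpotent:
  assumes "j < n" shows "\<exists>N. pts.dn N (\<lambda>x. x $ j)"
proof -
  obtain p where p: "p \<in> poly_funs (action_coords m n)" "\<And>g x. g \<in> G \<Longrightarrow> x \<in> X \<Longrightarrow> \<rho> g x $ j = p (g, x)"
    using act_poly[OF assms] by blast
  obtain N where N: "\<And>x. left.dn N (\<lambda>g. p (g, x))" using action_poly_nilpotent[OF p(1)] by blast
  have "pts.dn N (\<lambda>x. x $ j)"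
    by (rule orbit_difference_nilpotent, rule left.dn_cong[OF N]) (simp add: p(2))
  thus ?thesis by blast
qed

definition regular_fun :: "('k vec \<Rightarrow> 'k) \<Rightarrow> bool" where
  "regular_fun f \<longleftrightarrow> (\<exists>p\<in>poly_funs (vec_coords n). \<forall>x\<in>X. f x = p x)"

lemma regular_fun_translate:
  assumes "regular_fun f" "h \<in> G" shows "regular_fun (\<lambda>x. f (\<rho> h x))"
proof -
  obtain p where p: "p \<in> poly_funs (vec_coords n)" "\<And>x. x \<in> X \<Longrightarrow> f x = p x"
    using assms(1) by (auto simp: regular_fun_def)
  have "\<exists>q\<in>poly_funs (vec_coords n). \<forall>x\<in>X. p (\<rho> h x) = q x"
  proof (rule poly_funs_subst[OF p(1)])
    fix c :: "'k vec \<Rightarrow> 'k" assume "c \<in> vec_coords n"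
    then obtain j where j: "j < n" "c = (\<lambda>x. x $ j)" by (auto simp: vec_coords_def)
    obtain q where q: "q \<in> poly_funs (action_coords m n)" "\<And>g x. g \<in> G \<Longrightarrow> x \<in> X \<Longrightarrow> \<rho> g x $ j = q (g, x)"
      using act_poly[OF j(1)] by blast
    have "(\<lambda>x. q (h, x)) \<in> poly_funs (vec_coords n)"
    proof (rule poly_funs_subst_UNIV[where h = "\<lambda>x. (h, x)", OF q(1)])
      fix f :: "'k mat \<times> 'k vec \<Rightarrow> 'k" assume "f \<in> action_coords m n"
      then consider i j where "f = (\<lambda>(g, x). g $$ (i, j))" | "f = (\<lambda>(g, x). inverse (det g))"
        | i where "f = (\<lambda>(g, x). x $ i)" "i < n" by (auto simp: action_coords_def)
      thus "(\<lambda>x. f (h, x)) \<in> poly_funs (vec_coords n)"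
        by cases (auto intro: poly_funs.const poly_funs.gen simp: vec_coords_def)
    qed
    thus "\<exists>q\<in>poly_funs (vec_coords n). \<forall>x\<in>X. c (\<rho> h x) = q x"
      using q(2) assms(2) j(2) by (intro bexI[of _ "\<lambda>x. q (h, x)"]) auto
  qed
  thus ?thesis using p(2) assms(2) act_closed unfolding regular_fun_def by auto
qed

lemma regular_fun_diff:
  assumes "regular_fun f" "regular_fun g" shows "regular_fun (\<lambda>x. f x - g x)"
proof -
  obtain p q where "p \<in> poly_funs (vec_coords n)" "\<forall>x\<in>X. f x = p x" 
    "q \<in> poly_funs (vec_coords n)" "\<forall>x\<in>X. g x = q x"
    using assms unfolding regular_fun_def by blast
  thus ?thesis unfolding regular_fun_def
    by (intro bexI[OF _ poly_funs_diff[of p _ q]]) auto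
qed

text \<open>
  Replace \<open>f\<close> by one of its differences as long as some difference is nonconstant on the orbit of
  \<open>x\<close> under \<open>H\<close>; nilpotency stops this.
\<close>
lemma exists_semi_invariant:
  assumes H: "H \<subseteq> G" "\<And>g h. g \<in> H \<Longrightarrow> h \<in> H \<Longrightarrow> g * h \<in> H" and x: "x \<in> X"
    and "regular_fun f" "pts.dn N f" "h0 \<in> H" "f (\<rho> h0 x) \<noteq> f x"
  shows "\<exists>f'. regular_fun f' \<and> (\<exists>h\<in>H. f' (\<rho> h x) \<noteq> f' x) \<and>
    (\<forall>h\<in>H. \<forall>a\<in>H. f' (\<rho> h (\<rho> a x)) - f' (\<rho> a x) = f' (\<rho> h x) - f' x)"
  using assms(4-7)
proof (induction N arbitrary: f h0)
  case 0
  hence "f (\<rho> h0 x) = 0" "f x = 0" using x H(1) act_closed by auto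
  thus ?case using 0 by simp
next
  case (Suc N)
  show ?case
  proof (cases "\<forall>h\<in>H. \<forall>a\<in>H. f (\<rho> h (\<rho> a x)) - f (\<rho> a x) = f (\<rho> h x) - f x")
    case True thus ?thesis using Suc.prems by blast
  next
    case False
    then obtain h a where h: "h \<in> H" "a \<in> H" "f (\<rho> h (\<rho> a x)) - f (\<rho> a x) \<noteq> f (\<rho> h x) - f x" by blast
    have "regular_fun (\<lambda>y. f (\<rho> h y) - f y)"
      using regular_fun_diff regular_fun_translate Suc.prems(1) h(1) H(1) by blast
    moreover have "pts.dn N (\<lambda>y. f (\<rho> h y) - f y)" using Suc.prems(2) h(1) H(1) by auto
    ultimately show ?thesis using Suc.IH[of "\<lambda>y. f (\<rho> h y) - f y" a] h(2,3) by blast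
  qed
qed

text \<open>
  For a function \<open>f\<close> whose differences are constant on the orbit, \<open>\<chi> h = f (\<rho> h x) - f x\<close> is additive in
  \<open>h\<close>, so it vanishes on commutators, and \<open>f - f x\<close> separates the two orbits.
\<close>
lemma separating_polynomial:
  assumes H: "subgroup H K" and x: "x \<in> X" and h0: "h0 \<in> H" "\<rho> h0 x \<noteq> x"
  obtains p h where "p \<in> poly_funs (vec_coords n)" "h \<in> H" "p (\<rho> h x) \<noteq> 0"
    "\<And>d. d \<in> derived K H \<Longrightarrow> p (\<rho> d x) = 0"
proof -
  have HG: "H \<subseteq> G" using subgroup.subset[OF H] by simp
  have mult: "g * h \<in> H" if "g \<in> H" "h \<in> H" for g h
    using subgroup.m_closed[OF H that] by (simp add: GL_simps(2))
  have inv: "inv\<^bsub>K\<^esub> h \<in> H" if "h \<in> H" for h using subgroup.m_inv_closed[OF H that] .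
  have one: "1\<^sub>m m \<in> H" using subgroup.one_closed[OF H] by (simp add: GL_simps(3))
  have "\<rho> h0 x \<in> carrier_vec n" "x \<in> carrier_vec n" using x h0(1) HG act_closed X by blast+
  then obtain j where j: "j < n" "\<rho> h0 x $ j \<noteq> x $ j" using h0(2) by (metis carrier_vecD eq_vecI)
  have "regular_fun (\<lambda>x. x $ j)" unfolding regular_fun_def
    by (intro bexI[of _ "\<lambda>x. x $ j"] poly_funs.gen) (use j(1) in \<open>auto simp: vec_coords_def\<close>)
  then obtain f where f: "regular_fun f" "\<exists>h\<in>H. f (\<rho> h x) \<noteq> f x"
    "\<And>h a. h \<in> H \<Longrightarrow> a \<in> H \<Longrightarrow> f (\<rho> h (\<rho> a x)) - f (\<rho> a x) = f (\<rho> h x) - f x"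
    using coord_difference_nilpotent[OF j(1)] exists_semi_invariant[OF HG mult x _ _ h0(1), of "\<lambda>x. x $ j"] j(2)
    by blast
  define \<chi> where "\<chi> h = f (\<rho> h x) - f x" for h
  have chi_mult: "\<chi> (g * h) = \<chi> g + \<chi> h" if "g \<in> H" "h \<in> H" for g h
  proof -
    have "\<rho> (g * h) x = \<rho> g (\<rho> h x)" using that HG x by (intro act_mult) auto
    thus ?thesis using f(3)[OF that] by (simp add: \<chi>_def algebra_simps)
  qed
  have chi_one: "\<chi> (1\<^sub>m m) = 0" using act_one[OF x] by (simp add: \<chi>_def)
  have chi_inv: "\<chi> (inv\<^bsub>K\<^esub> h) = - \<chi> h" if "h \<in> H" for h
  proof -
    have "h * inv\<^bsub>K\<^esub> h = 1\<^sub>m m" using inv_mat(2) that HG by blast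
    hence "\<chi> h + \<chi> (inv\<^bsub>K\<^esub> h) = 0" using chi_mult[OF that inv[OF that]] chi_one by simp
    thus ?thesis by (simp add: eq_neg_iff_add_eq_0 add.commute)
  qed
  define D where "D = (\<Union>a\<in>H. \<Union>b\<in>H. {a * b * inv\<^bsub>K\<^esub> a * inv\<^bsub>K\<^esub> b})"
  have D: "derived K H = generate K D" by (simp add: derived_def D_def GL_simps(2))
  have chi_D: "\<chi> d = 0" "d \<in> H" if d: "d \<in> D" for d
  proof -
    obtain a b where ab: "a \<in> H" "b \<in> H" "d = a * b * inv\<^bsub>K\<^esub> a * inv\<^bsub>K\<^esub> b"
      using d by (auto simp: D_def)
    show "\<chi> d = 0" "d \<in> H" unfolding ab(3)
      using ab(1,2) by (simp_all add: chi_mult chi_inv mult inv)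
  qed
  have "\<chi> d = 0 \<and> d \<in> H" if "d \<in> generate K D" for d
    using that
  proof (induction rule: generate.induct)
    case one thus ?case using chi_one \<open>1\<^sub>m m \<in> H\<close> by (simp add: GL_simps(3))
  next
    case (incl d) thus ?case using chi_D by blast
  next
    case (inv d) thus ?case using chi_D[OF inv] chi_inv \<open>\<And>h. h \<in> H \<Longrightarrow> inv\<^bsub>K\<^esub> h \<in> H\<close> by simp
  next
    case (eng a b) thus ?case using chi_mult mult by (simp add: GL_simps(2))
  qed
  hence chi_derived: "\<chi> d = 0" "d \<in> H" if "d \<in> derived K H" for d using that unfolding D by auto
  obtain p where p: "p \<in> poly_funs (vec_coords n)" "\<And>y. y \<in> X \<Longrightarrow> f y = p y"
    using f(1) by (auto simp: regular_fun_def)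
  obtain h where h: "h \<in> H" "f (\<rho> h x) \<noteq> f x" using f(2) by blast
  show thesis
  proof (rule that)
    show "(\<lambda>y. p y - f x) \<in> poly_funs (vec_coords n)" by (intro poly_funs_diff poly_funs.const p(1))
    show "h \<in> H" by fact
    have "\<rho> h x \<in> X" using h(1) HG x act_closed by blast
    thus "p (\<rho> h x) - f x \<noteq> 0" using h(2) p(2) by simp
    fix d assume d: "d \<in> derived K H"
    have "\<rho> d x \<in> X" using chi_derived(2)[OF d] HG x act_closed by blast
    thus "p (\<rho> d x) - f x = 0" using chi_derived(1)[OF d] p(2) by (simp add: \<chi>_def)
  qed
qed

lemma path_pullback:
  assumes \<gamma>: "poly_path \<gamma>" and y: "y \<in> X" and f: "f \<in> poly_funs (vec_coords n)"
  shows "(\<lambda>t. f (\<rho> (\<gamma> t) y)) \<in> upoly_funs"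
proof (rule poly_funs_subst_UNIV[where h = "\<lambda>t. \<rho> (\<gamma> t) y", OF f])
  have mem: "\<gamma> t \<in> G" for t using \<gamma> by (simp add: poly_path_def)
  fix c :: "'k vec \<Rightarrow> 'k" assume "c \<in> vec_coords n"
  then obtain j where j: "j < n" "c = (\<lambda>x. x $ j)" by (auto simp: vec_coords_def)
  obtain q where q: "q \<in> poly_funs (action_coords m n)" "\<And>g x. g \<in> G \<Longrightarrow> x \<in> X \<Longrightarrow> \<rho> g x $ j = q (g, x)"
    using act_poly[OF j(1)] by blast
  have "(\<lambda>t. q (\<gamma> t, y)) \<in> upoly_funs"
  proof (rule poly_funs_subst_UNIV[where h = "\<lambda>t. (\<gamma> t, y)", OF q(1)])
    fix f :: "'k mat \<times> 'k vec \<Rightarrow> 'k" assume "f \<in> action_coords m n"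
    then consider i j where "f = (\<lambda>(g, x). g $$ (i, j))" "i < m" "j < m" | "f = (\<lambda>(g, x). inverse (det g))"
      | i where "f = (\<lambda>(g, x). x $ i)" "i < n" by (auto simp: action_coords_def)
    thus "(\<lambda>t. f (\<gamma> t, y)) \<in> upoly_funs"
    proof cases
      case 1 thus ?thesis using \<gamma> by (simp add: poly_path_def)
    next
      case 2 thus ?thesis using det_one[OF mem] by (simp add: poly_funs.const)
    next
      case 3 thus ?thesis by (simp add: poly_funs.const)
    qed
  qed
  thus "(\<lambda>t. c (\<rho> (\<gamma> t) y)) \<in> upoly_funs" using q(2)[OF mem y] j(2) by simp
qed

text \<open>
  If the orbit had points \<open>p\<close> outside \<open>A\<close> and \<open>q\<close> outside \<open>B\<close>, choose equations \<open>f\<close> of \<open>A\<close> and \<open>g\<close> of \<open>B\<close>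
  with \<open>f p\<close> and \<open>g q\<close> nonzero.  Along a polynomial curve in the orbit from \<open>p\<close> to \<open>q\<close> the product
  \<open>f g\<close> vanishes, although neither factor vanishes identically.
\<close>
lemma orbit_irreducible:
  assumes H: "subgroup H K" "path_connected_subset H" and x: "x \<in> X"
    and Y: "(\<lambda>h. \<rho> h x) ` H \<subseteq> Y"
  shows "irreducible_in (subtopology (zariski n) Y) ((\<lambda>h. \<rho> h x) ` H)"
  unfolding irreducible_in_def
proof (intro conjI allI impI)
  let ?O = "(\<lambda>h. \<rho> h x) ` H"
  have HG: "H \<subseteq> G" using subgroup.subset[OF H(1)] by simp
  have mult: "g * h \<in> H" if "g \<in> H" "h \<in> H" for g h
    using subgroup.m_closed[OF H(1) that] by (simp add: GL_simps(2))
  have one: "1\<^sub>m m \<in> H" using subgroup.one_closed[OF H(1)] by (simp add: GL_simps(3))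
  have OX: "?O \<subseteq> X" using x HG act_closed by auto
  show "?O \<subseteq> topspace (subtopology (zariski n) Y)" using OX X Y by (auto simp: topspace_zariski)
  show "?O \<noteq> {}" using one by blast
  fix A B assume AB: "closedin (subtopology (zariski n) Y) A" "closedin (subtopology (zariski n) Y) B" "?O \<subseteq> A \<union> B"
  have closed: "\<exists>S \<subseteq> poly_funs (vec_coords n). \<forall>y\<in>?O. y \<in> C \<longleftrightarrow> (\<forall>f\<in>S. f y = 0)"
    if C: "closedin (subtopology (zariski n) Y) C" for C
  proof -
    obtain E where E: "closedin (zariski n) E" "C = E \<inter> Y" using C by (auto simp: closedin_subtopology)
    obtain S where "S \<subseteq> poly_funs (vec_coords n)" "E = zero_locus n S"
      using E(1) unfolding closedin_zariski affine_variety_def by blast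
    thus ?thesis using E(2) Y OX X by (intro exI[of _ S]) (auto simp: zero_locus_def)
  qed
  obtain S where S: "S \<subseteq> poly_funs (vec_coords n)" "\<And>y. y \<in> ?O \<Longrightarrow> y \<in> A \<longleftrightarrow> (\<forall>f\<in>S. f y = 0)"
    using closed[OF AB(1)] by blast
  obtain T where T: "T \<subseteq> poly_funs (vec_coords n)" "\<And>y. y \<in> ?O \<Longrightarrow> y \<in> B \<longleftrightarrow> (\<forall>f\<in>T. f y = 0)"
    using closed[OF AB(2)] by blast
  show "?O \<subseteq> A \<or> ?O \<subseteq> B"
  proof (rule ccontr)
    assume "\<not> (?O \<subseteq> A \<or> ?O \<subseteq> B)"
    then obtain a b where ab: "a \<in> H" "\<rho> a x \<notin> A" "b \<in> H" "\<rho> b x \<notin> B" by auto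
    obtain f where f: "f \<in> S" "f (\<rho> a x) \<noteq> 0" using S(2)[of "\<rho> a x"] ab by blast
    obtain g where g: "g \<in> T" "g (\<rho> b x) \<noteq> 0" using T(2)[of "\<rho> b x"] ab by blast
    define y where "y = \<rho> a x"
    have y: "y \<in> X" using OX ab(1) by (auto simp: y_def)
    have "b * inv\<^bsub>K\<^esub> a \<in> H" using mult subgroup.m_inv_closed[OF H(1)] ab by blast
    then obtain \<gamma> where \<gamma>: "poly_path \<gamma>" "range \<gamma> \<subseteq> H" "\<gamma> 0 = 1\<^sub>m m" "\<gamma> 1 = b * inv\<^bsub>K\<^esub> a"
      using H(2) unfolding path_connected_subset_def by blast
    have \<gamma>H: "\<gamma> t \<in> H" for t using \<gamma>(2) by auto
    have gy: "\<rho> (\<gamma> t) y = \<rho> (\<gamma> t * a) x" for t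
      unfolding y_def using \<gamma>H[of t] ab(1) HG x by (intro act_mult[symmetric]) auto
    have vanish: "f (\<rho> (\<gamma> t) y) * g (\<rho> (\<gamma> t) y) = 0" for t
    proof -
      have mem: "\<rho> (\<gamma> t) y \<in> ?O" unfolding gy by (rule imageI) (rule mult[OF \<gamma>H ab(1)])
      hence "\<rho> (\<gamma> t) y \<in> A \<or> \<rho> (\<gamma> t) y \<in> B" using AB(3) by blast
      hence "f (\<rho> (\<gamma> t) y) = 0 \<or> g (\<rho> (\<gamma> t) y) = 0"
        using S(2)[OF mem] T(2)[OF mem] f(1) g(1) by blast
      thus ?thesis by auto
    qed
    have "(\<lambda>t. f (\<rho> (\<gamma> t) y)) \<in> upoly_funs" "(\<lambda>t. g (\<rho> (\<gamma> t) y)) \<in> upoly_funs"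
      using S(1) T(1) f(1) g(1) by (auto intro!: path_pullback[OF \<gamma>(1) y])
    hence "(\<forall>t. f (\<rho> (\<gamma> t) y) = 0) \<or> (\<forall>t. g (\<rho> (\<gamma> t) y) = 0)"
      using vanish by (rule upoly_funs_idom)
    hence "f (\<rho> (\<gamma> 0) y) = 0 \<or> g (\<rho> (\<gamma> 1) y) = 0" by blast
    moreover have "\<rho> (\<gamma> 0) y = \<rho> a x" using \<gamma>(3) act_one[OF y] by (simp add: y_def)
    moreover have "\<rho> (\<gamma> 1) y = \<rho> b x"
    proof -
      have "b * inv\<^bsub>K\<^esub> a * a = b * (inv\<^bsub>K\<^esub> a * a)"
        using ab HG inv_mat(1) by (intro assoc_mult_mat[of _ m m _ m _ m] carr) auto
      also have "inv\<^bsub>K\<^esub> a * a = 1\<^sub>m m" using ab HG inv_mat(3) by blast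
      also have "b * 1\<^sub>m m = b" using ab HG carr by (intro right_mult_one_mat) auto
      finally show ?thesis using gy[of 1] \<gamma>(4) by simp
    qed
    ultimately show False using f(2) g(2) by simp
  qed
qed

abbreviation "Gd k \<equiv> (derived K ^^ k) G"

lemma Gd_subgroup: "subgroup (Gd k) K"
  using K.exp_of_derived_is_subgroup[OF K.subgroup_self] by simp

lemma Gd_Suc: "Gd (Suc k) \<subseteq> Gd k"
  using K.derived_incl[OF order_refl Gd_subgroup[of k]] by simp

lemma Gd_antimono: "k \<le> l \<Longrightarrow> Gd l \<subseteq> Gd k"
  by (induction rule: dec_induct) (use Gd_Suc in blast)+

text \<open>
  The closures of the orbits of \<open>x\<close> under the derived subgroups of orders \<open>Suc d, \<dots>, 0\<close> form a strictly
  increasing chain of length \<open>Suc d\<close>.  They are taken inside an arbitrary set \<open>Y\<close> containing the orbit of \<open>x\<close>,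
  so that \<open>Y\<close> can be the orbit of a larger group.
\<close>
theorem derived_moves_imp_dim_ge:
  assumes x: "x \<in> X" and h: "h \<in> Gd d" "\<rho> h x \<noteq> x" and Y: "(\<lambda>g. \<rho> g x) ` G \<subseteq> Y"
  shows "enat (Suc d) \<le> variety_dim n Y"
proof -
  define T where "T = subtopology (zariski n) Y"
  define Orb where "Orb k = (\<lambda>g. \<rho> g x) ` Gd k" for k
  have GdG: "Gd k \<subseteq> G" for k using subgroup.subset[OF Gd_subgroup[of k]] by simp
  have OY: "Orb k \<subseteq> Y" for k using Y GdG by (auto simp: Orb_def)
  have OX: "Orb k \<subseteq> carrier_vec n" for k using GdG[of k] act_closed[OF _ x] X by (auto simp: Orb_def)
  have Ot: "Orb k \<subseteq> topspace T" for k using OY OX by (auto simp: T_def topspace_zariski)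
  have pc: "path_connected_subset (Gd k)" for k
    using path_connected_exp_derived unipotent_group_path_connected[OF unip] by blast
  have irr: "irreducible_in T (Orb k)" for k
    unfolding T_def Orb_def using OY[of k] by (intro orbit_irreducible Gd_subgroup pc x) (simp add: Orb_def)
  have strict: "T closure_of (Orb (Suc k)) \<subset> T closure_of (Orb k)" if k: "k \<le> d" for k
  proof -
    have "h \<in> Gd k" using h(1) Gd_antimono[OF k] by blast
    then obtain p a where p: "p \<in> poly_funs (vec_coords n)" "a \<in> Gd k" "p (\<rho> a x) \<noteq> 0"
      "\<And>b. b \<in> derived K (Gd k) \<Longrightarrow> p (\<rho> b x) = 0"
      using separating_polynomial[OF Gd_subgroup x _ h(2)] by metis
    define Z where "Z = Y \<inter> zero_locus n {p}"
    have "closedin (zariski n) (zero_locus n {p})"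
      unfolding closedin_zariski affine_variety_def using p(1) by blast
    hence "closedin T Z" unfolding T_def Z_def by (rule closedin_subtopology_Int_closed)
    moreover have "Orb (Suc k) \<subseteq> Z"
      using p(4) OY[of "Suc k"] OX[of "Suc k"] by (auto simp: Z_def Orb_def zero_locus_def)
    ultimately have "T closure_of (Orb (Suc k)) \<subseteq> Z" by (intro closure_of_minimal)
    moreover have "\<rho> a x \<notin> Z" using p(3) by (simp add: Z_def zero_locus_def)
    moreover have "\<rho> a x \<in> T closure_of (Orb k)"
      using closure_of_subset[OF Ot[of k]] p(2) by (auto simp: Orb_def)
    moreover have "T closure_of (Orb (Suc k)) \<subseteq> T closure_of (Orb k)"
      using Gd_Suc[of k] by (intro closure_of_mono) (auto simp: Orb_def)
    ultimately show ?thesis by blast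
  qed
  define C where "C i = T closure_of (Orb (Suc d - i))" for i
  have "C i \<subset> C (Suc i)" if "i < Suc d" for i
    using strict[of "d - i"] that by (simp add: C_def Suc_diff_le)
  moreover have "closedin T (C i) \<and> irreducible_in T (C i)" for i
    unfolding C_def using irr irreducible_in_closure by auto
  ultimately have "\<exists>C. (\<forall>i\<le>Suc d. closedin T (C i) \<and> irreducible_in T (C i)) \<and> (\<forall>i<Suc d. C i \<subset> C (Suc i))"
    by (intro exI[of _ C]) auto
  hence "enat (Suc d) \<le> krull_dim T" unfolding krull_dim_def by (intro Sup_upper) blast
  thus ?thesis by (simp add: variety_dim_def T_def)
qed

end

section \<open>Derived series of an ascending union\<close>

text \<open>Any element of the left side involves finitely many commutators, whose entries lie in one common \<open>A i\<close>.\<close>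
lemma (in group) derived_Union_chain:
  assumes sub: "\<And>i. A i \<subseteq> carrier G" and chain: "\<And>i. A i \<subseteq> A (Suc i)"
  shows "derived G (\<Union>i::nat. A i) \<subseteq> (\<Union>i. derived G (A i))"
proof
  have mono: "A i \<subseteq> A j" if "i \<le> j" for i j by (rule lift_Suc_mono_le[of A, OF chain that])
  have dmono: "derived G (A i) \<subseteq> derived G (A j)" if "i \<le> j" for i j
    by (rule mono_derived[OF mono[OF that]])
  have comm: "\<exists>i. c \<in> derived_set G (A i)" if c: "c \<in> derived_set G (\<Union>i. A i)" for c
  proof -
    obtain a b i j where ab: "a \<in> A i" "b \<in> A j" "c = a \<otimes> b \<otimes> inv a \<otimes> inv b" using c by auto
    hence "a \<in> A (max i j)" "b \<in> A (max i j)" using mono[of i "max i j"] mono[of j "max i j"] by auto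
    thus ?thesis using ab(3) by blast
  qed
  fix u assume "u \<in> derived G (\<Union>i. A i)"
  hence "u \<in> generate G (derived_set G (\<Union>i. A i))" by (simp add: derived_def)
  hence "\<exists>i. u \<in> derived G (A i)"
  proof (induction rule: generate.induct)
    case one show ?case unfolding derived_def by (blast intro: generate.one)
  next
    case (incl c) thus ?case using comm[OF incl] unfolding derived_def by (blast intro: generate.incl)
  next
    case (inv c) thus ?case using comm[OF inv] unfolding derived_def by (blast intro: generate.inv)
  next
    case (eng a b)
    then obtain i j where "a \<in> derived G (A i)" "b \<in> derived G (A j)" by blast
    hence "a \<in> derived G (A (max i j))" "b \<in> derived G (A (max i j))"
      using dmono[of i "max i j"] dmono[of j "max i j"] by auto
    hence "a \<otimes> b \<in> derived G (A (max i j))" unfolding derived_def by (rule generate.eng)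
    thus ?case by blast
  qed
  thus "u \<in> (\<Union>i. derived G (A i))" by blast
qed

lemma (in group) exp_derived_Union_chain:
  assumes sub: "\<And>i. A i \<subseteq> carrier G" and chain: "\<And>i. A i \<subseteq> A (Suc i)"
  shows "(derived G ^^ k) (\<Union>i::nat. A i) \<subseteq> (\<Union>i. (derived G ^^ k) (A i))"
proof (induction k)
  case (Suc k)
  have "(derived G ^^ Suc k) (\<Union>i. A i) = derived G ((derived G ^^ k) (\<Union>i. A i))" by simp
  also have "\<dots> \<subseteq> derived G (\<Union>i. (derived G ^^ k) (A i))" by (rule mono_derived[OF Suc.IH])
  also have "\<dots> \<subseteq> (\<Union>i. derived G ((derived G ^^ k) (A i)))"
    by (rule derived_Union_chain) (rule exp_of_derived_in_carrier[OF sub], rule mono_exp_of_derived[OF chain])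
  finally show ?case by simp
qed simp

lemma (in group) exp_derived_consistent:
  assumes "subgroup H G" shows "(derived (G\<lparr>carrier := H\<rparr>) ^^ k) H = (derived G ^^ k) H"
proof (induction k)
  case (Suc k)
  have "(derived G ^^ k) H \<subseteq> H"
    by (induction k) (use derived_incl[OF _ assms] in auto)
  thus ?case using derived_consistent[OF _ assms] Suc by simp
qed simp

lemma regular_self_map_compose:
  assumes f: "regular_self_map n X f" and g: "regular_self_map n X g"
    and h: "\<And>x. x \<in> X \<Longrightarrow> h x = f (g x)"
  shows "regular_self_map n X h"
  unfolding regular_self_map_def
proof (intro conjI allI impI)
  have gX: "g x \<in> X" if "x \<in> X" for x using g that by (auto simp: regular_self_map_def)
  show "h \<in> X \<rightarrow> X" using f gX h by (auto simp: regular_self_map_def)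
  fix j assume "j < n"
  then obtain p where p: "p \<in> poly_funs (vec_coords n)" "\<And>x. x \<in> X \<Longrightarrow> f x $ j = p x"
    using f unfolding regular_self_map_def by blast
  have "\<exists>q\<in>poly_funs (vec_coords n). \<forall>x\<in>X. p (g x) = q x"
  proof (rule poly_funs_subst[OF p(1)])
    fix c :: "'a vec \<Rightarrow> 'a" assume "c \<in> vec_coords n"
    then obtain i where "i < n" "c = (\<lambda>x. x $ i)" by (auto simp: vec_coords_def)
    thus "\<exists>q\<in>poly_funs (vec_coords n). \<forall>x\<in>X. c (g x) = q x"
      using g unfolding regular_self_map_def by simp
  qed
  thus "\<exists>q\<in>poly_funs (vec_coords n). \<forall>x\<in>X. h x $ j = q x" using p(2) gX h by simp
qed

lemma regular_self_map_id:
  assumes "\<And>x. x \<in> X \<Longrightarrow> h x = x" shows "regular_self_map n X h"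
  unfolding regular_self_map_def
proof (intro conjI allI impI)
  show "h \<in> X \<rightarrow> X" using assms by auto
  fix j assume "j < n"
  hence "(\<lambda>x. x $ j) \<in> poly_funs (vec_coords n)" by (intro poly_funs.gen) (auto simp: vec_coords_def)
  thus "\<exists>p\<in>poly_funs (vec_coords n). \<forall>x\<in>X. h x $ j = p x" using assms by (intro bexI) auto
qed

text \<open>
  This identifies products, inverses and derived subgroups in \<open>Aut n X\<close> with those in the group of all
  bijections of \<open>X\<close>, which contains the images of all the matrix groups that act.
\<close>
lemma Aut_subgroup_BijGroup: "subgroup (carrier (Aut n X)) (BijGroup X)"
proof -
  interpret B: group "BijGroup X" by (rule group_BijGroup)
  have car: "f \<in> carrier (Aut n X) \<longleftrightarrow> f \<in> Bij X \<and> regular_self_map n X f \<and> regular_self_map n X (inv_into X f)" for f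
    by (simp add: Aut_def)
  have bij: "bij_betw f X X" if "f \<in> Bij X" for f using that by (simp add: Bij_def)
  have one: "(\<lambda>x\<in>X. x) \<in> carrier (Aut n X)"
  proof -
    have "inv_into X (\<lambda>x\<in>X. x) x = x" if "x \<in> X" for x
      using that by (intro inv_into_f_eq) (auto simp: inj_on_def)
    thus ?thesis unfolding car using id_Bij by (auto intro!: regular_self_map_id)
  qed
  show ?thesis
  proof (rule B.subgroupI)
    show "carrier (Aut n X) \<subseteq> carrier (BijGroup X)" by (auto simp: car BijGroup_def)
    show "carrier (Aut n X) \<noteq> {}" using one by blast
  next
    fix f assume f: "f \<in> carrier (Aut n X)"
    hence fb: "f \<in> Bij X" by (simp add: car)
    have eq: "inv\<^bsub>BijGroup X\<^esub> f = (\<lambda>x\<in>X. inv_into X f x)" by (rule inv_BijGroup[OF fb])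
    have "inv_into X (\<lambda>x\<in>X. inv_into X f x) x = f x" if x: "x \<in> X" for x
    proof (rule inv_into_f_eq)
      have "inj_on (inv_into X f) X" using bij_betw_inv_into[OF bij[OF fb]] by (simp add: bij_betw_def)
      thus "inj_on (\<lambda>x\<in>X. inv_into X f x) X" by (simp add: inj_on_def)
      show "f x \<in> X" using bij[OF fb] x by (auto simp: bij_betw_def)
      thus "(\<lambda>x\<in>X. inv_into X f x) (f x) = x" using bij[OF fb] x by (simp add: bij_betw_def)
    qed
    hence "regular_self_map n X (inv_into X (\<lambda>x\<in>X. inv_into X f x))"
      using f regular_self_map_compose[of n X f "\<lambda>x. x"] regular_self_map_id[of X "\<lambda>x. x" n] by (auto simp: car)
    moreover have "regular_self_map n X (\<lambda>x\<in>X. inv_into X f x)"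
      using f regular_self_map_compose[of n X "inv_into X f" "\<lambda>x. x"] regular_self_map_id[of X "\<lambda>x. x" n] by (auto simp: car)
    ultimately show "inv\<^bsub>BijGroup X\<^esub> f \<in> carrier (Aut n X)"
      unfolding eq car using restrict_inv_into_Bij[OF fb] by blast
  next
    fix f g assume fg: "f \<in> carrier (Aut n X)" "g \<in> carrier (Aut n X)"
    hence b: "f \<in> Bij X" "g \<in> Bij X" by (auto simp: car)
    have eq: "f \<otimes>\<^bsub>BijGroup X\<^esub> g = compose X f g" using b by (simp add: BijGroup_def)
    have "inv_into X (compose X f g) x = inv_into X g (inv_into X f x)" if x: "x \<in> X" for x
    proof (rule inv_into_f_eq)
      show "inj_on (compose X f g) X" using compose_Bij[OF b] by (auto simp: Bij_def bij_betw_def)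
      have 1: "inv_into X f x \<in> X" by (rule Bij_inv_into_mem[OF b(1) x])
      show 2: "inv_into X g (inv_into X f x) \<in> X" by (rule Bij_inv_into_mem[OF b(2) 1])
      show "compose X f g (inv_into X g (inv_into X f x)) = x"
        using bij_betw_inv_into_right[OF bij[OF b(2)] 1] bij_betw_inv_into_right[OF bij[OF b(1)] x] 2
        by (simp add: compose_eq)
    qed
    hence "regular_self_map n X (inv_into X (compose X f g))"
      using fg regular_self_map_compose[of n X "inv_into X g" "inv_into X f"] by (simp add: car)
    moreover have "regular_self_map n X (compose X f g)"
      using fg regular_self_map_compose[of n X f g "compose X f g"] by (simp add: car compose_eq)
    ultimately show "f \<otimes>\<^bsub>BijGroup X\<^esub> g \<in> carrier (Aut n X)"
      unfolding eq car using compose_Bij[OF b] by blast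
  qed
qed

text \<open>
  An element of \<open>U\<^sup>(\<^sup>d\<^sup>)\<close> lies in the image of the \<open>d\<close>-th derived subgroup of a single matrix group; if it
  moved a point, the orbit of that point would have dimension above \<open>d\<close>.
\<close>
lemma nested_unipotent_derived_trivial:
  fixes X :: "'k::{alg_closed_field, field_char_0} vec set"
  assumes X: "X \<subseteq> carrier_vec n" and U: "nested_unipotent_subgroup n X U"
    and d: "\<And>x. x \<in> X \<Longrightarrow> variety_dim n {u x | u. u \<in> U} \<le> enat d"
    and u: "u \<in> (derived (BijGroup X) ^^ d) U"
  shows "u = (\<lambda>x\<in>X. x)"
proof -
  interpret B: group "BijGroup X" by (rule group_BijGroup)
  obtain V :: "nat \<Rightarrow> _" where V: "\<And>i. unipotent_algebraic_subgroup n X (V i)" "\<And>i. V i \<subseteq> V (Suc i)" "U = (\<Union>i. V i)"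
    using U unfolding nested_unipotent_subgroup_def by blast
  have Vsub: "V i \<subseteq> carrier (BijGroup X)" for i
  proof -
    have "V i \<subseteq> carrier (Aut n X)" 
      using V(1)[of i] subgroup.subset unfolding unipotent_algebraic_subgroup_def by blast
    thus ?thesis using subgroup.subset[OF Aut_subgroup_BijGroup[of n X]] by blast
  qed
  obtain i where i: "u \<in> (derived (BijGroup X) ^^ d) (V i)"
    using u B.exp_derived_Union_chain[of V d, OF Vsub V(2)] unfolding V(3) by blast
  obtain m G \<rho> where G: "unipotent_group m G" "regular_action m G n X \<rho>" "V i = \<rho> ` G"
    using V(1)[of i] unfolding unipotent_algebraic_subgroup_def by blast
  interpret unipotent_action m G n X \<rho> by (rule unipotent_action.intro[OF G(1,2) X])
  interpret hom: group_hom K "BijGroup X" \<rho>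
    using G(2) unfolding regular_action_def group_action_def by blast
  have "(derived (BijGroup X) ^^ d) (V i) = \<rho> ` ((derived K ^^ d) G)"
    unfolding G(3) by (rule hom.exp_of_derived_img) simp
  then obtain h where h: "h \<in> (derived K ^^ d) G" "u = \<rho> h" using i by blast
  have "u x = x" if x: "x \<in> X" for x
  proof (rule ccontr)
    assume "u x \<noteq> x"
    moreover have "(\<lambda>g. \<rho> g x) ` G \<subseteq> {u x | u. u \<in> U}" using G(3) V(3) by blast
    ultimately have "enat (Suc d) \<le> variety_dim n {u x | u. u \<in> U}"
      using derived_moves_imp_dim_ge[OF x h(1)] h(2) by blast
    also have "\<dots> \<le> enat d" by (rule d[OF x])
    finally show False by simp
  qed
  moreover have "u \<in> Bij X"
    using i B.exp_of_derived_in_carrier[OF Vsub[of i], of d] by (auto simp: BijGroup_def)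
  ultimately show ?thesis by (auto simp: Bij_def extensional_def)
qed

section \<open>The bound on the derived length\<close>

theorem theoremC:
  fixes n :: nat
    and X :: "'k::{alg_closed_field, field_char_0} vec set"
    and U :: "('k vec \<Rightarrow> 'k vec) set"
  assumes "affine_variety n X" and "X \<noteq> {}"
    and "nested_unipotent_subgroup n X U"
  shows "solvable ((Aut n X)\<lparr>carrier := U\<rparr>) \<and>
    enat (derived_length ((Aut n X)\<lparr>carrier := U\<rparr>))
      \<le> Max {variety_dim n {u x | u. u \<in> U} | x. x \<in> X} \<and>
    Max {variety_dim n {u x | u. u \<in> U} | x. x \<in> X} \<le> variety_dim n X"
proof -
  interpret B: group "BijGroup X" by (rule group_BijGroup)
  let ?D = "{variety_dim n {u x | u. u \<in> U} | x. x \<in> X}"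
  let ?A = "(Aut n X)\<lparr>carrier := U\<rparr>"
  have X: "X \<subseteq> carrier_vec n" using assms(1) by (auto simp: affine_variety_def zero_locus_def)
  have Aut: "Aut n X = (BijGroup X)\<lparr>carrier := carrier (Aut n X)\<rparr>" by (simp add: Aut_def)
  have "subgroup U (Aut n X)" using assms(3) by (simp add: nested_unipotent_subgroup_def)
  hence U: "subgroup U (BijGroup X)"
    using B.incl_subgroup[OF Aut_subgroup_BijGroup[of n X], of U] Aut by simp
  have A: "?A = (BijGroup X)\<lparr>carrier := U\<rparr>" by (simp add: Aut_def)
  interpret A: group ?A unfolding A by (rule B.subgroup_imp_group[OF U])
  have "finite ?D" by (rule finite_enat_bounded[of _ n]) (auto intro: variety_dim_le)
  moreover have "?D \<noteq> {}" using assms(2) by blast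
  ultimately have Max: "Max ?D \<in> ?D" "\<And>e. e \<in> ?D \<Longrightarrow> e \<le> Max ?D"
    by (rule Max_in, intro Max_ge)
  have "Max ?D \<le> enat n" using Max(1) variety_dim_le by force
  then obtain d where d: "Max ?D = enat d" by (cases "Max ?D") auto
  have one: "\<one>\<^bsub>BijGroup X\<^esub> = (\<lambda>x\<in>X. x)" by (simp add: BijGroup_def)
  have "(derived (BijGroup X) ^^ d) U \<subseteq> {\<one>\<^bsub>BijGroup X\<^esub>}"
  proof
    fix u assume u: "u \<in> (derived (BijGroup X) ^^ d) U"
    have "variety_dim n {u x | u. u \<in> U} \<le> enat d" if "x \<in> X" for x
      using Max(2) that unfolding d by blast
    hence "u = (\<lambda>x\<in>X. x)" by (rule nested_unipotent_derived_trivial[OF X assms(3) _ u])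
    thus "u \<in> {\<one>\<^bsub>BijGroup X\<^esub>}" by (simp add: one)
  qed
  moreover have "\<one>\<^bsub>BijGroup X\<^esub> \<in> (derived (BijGroup X) ^^ d) U"
    by (rule subgroup.one_closed[OF B.exp_of_derived_is_subgroup[OF U]])
  ultimately have "(derived (BijGroup X) ^^ d) U = {\<one>\<^bsub>BijGroup X\<^esub>}" by blast
  hence triv: "(derived ?A ^^ d) (carrier ?A) = {\<one>\<^bsub>?A\<^esub>}"
    unfolding A using B.exp_derived_consistent[OF U, of d] by simp
  have "solvable ?A" using triv A.solvable_iff_trivial_derived_seq by blast
  moreover have "derived_length ?A \<le> d" unfolding derived_length_def by (rule Least_le) (rule triv)
  moreover have "Max ?D \<le> variety_dim n X"
  proof -
    obtain x where x: "x \<in> X" "Max ?D = variety_dim n {u x | u. u \<in> U}" using Max(1) by blast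
    have "{u x | u. u \<in> U} \<subseteq> X"
      using subgroup.subset[OF U] x(1) Bij_imp_funcset by (fastforce simp: BijGroup_def)
    thus ?thesis unfolding x(2) by (rule variety_dim_mono)
  qed
  ultimately show ?thesis unfolding d by simp
qed

end
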